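(* Let $a,b>-1$ and, for $j=0,1,2,\ldots$, let $$\varphi_j(x)=\frac{1}{\sqrt{h_j^{(a,b)}}}P_j^{(a,b)}(x)(1-x)^{a/2}(1+x)^{b/2},\qquad x\in[-1,1],$$ and $K_N^{(2)}(x,y)=\sum_{j=0}^{N-1}\varphi_j(x)\varphi_j(y)$. Then for $x,y\in\mathbb{R}$, as $N\to\infty$, $$\frac{1}{N}K_N^{(2)}\left(\frac{x}{N},\frac{y}{N}\right)=K_{\mathrm{sine}}(x,y)+O(N^{-1}),$$ where $K_{\mathrm{sine}}(x,y)=\frac{\sin(x-y)}{\pi(x-y)}$ (with $K_{\mathrm{sine}}(x,x)=1/\pi$). The error term is uniform for $x$ and $y$ in compact subsets of $\mathbb{R}$.
   Context: $P_j^{(a,b)}$ denotes the Jacobi polynomial of degree $j$, orthogonal on $[-1,1]$ with respect to $(1-x)^a(1+x)^b$: $\int_{-1}^1 P_j^{(a,b)}P_k^{(a,b)}(1-x)^a(1+x)^b\,dx=h_j^{(a,b)}\delta_{jk}$, where $h_j^{(a,b)}=\frac{2^{a+b+1}\Gamma(j+a+1)\Gamma(j+b+1)}{j!(2j+a+b+1)\Gamma(j+a+b+1)}$ (standard normalization of Szegő). Thus $\{\varphi_j\}$ is orthonormal in $L^2[-1,1]$. *)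

theory Defs
  imports "HOL-Analysis.Analysis"
begin

definition jacobiP :: "nat \<Rightarrow> real \<Rightarrow> real \<Rightarrow> real \<Rightarrow> real" where
  "jacobiP n a b x =
     (\<Sum>s\<le>n. ((real n + a) gchoose (n - s)) * ((real n + b) gchoose s)
              * ((x - 1) / 2) ^ s * ((x + 1) / 2) ^ (n - s))"

text \<open>Squared norm h_j^(a,b). For j = 0 the factor (a+b+1) Gamma(a+b+1) is written
  as Gamma(a+b+2) (the standard convention, also covering a+b+1 = 0).\<close>
definition jacobi_h :: "nat \<Rightarrow> real \<Rightarrow> real \<Rightarrow> real" where
  "jacobi_h j a b =
     (if j = 0 then 2 powr (a + b + 1) * Gamma (a + 1) * Gamma (b + 1) / Gamma (a + b + 2)
      else 2 powr (a + b + 1) * Gamma (real j + a + 1) * Gamma (real j + b + 1)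
           / (fact j * (2 * real j + a + b + 1) * Gamma (real j + a + b + 1)))"

definition jacobi_phi :: "nat \<Rightarrow> real \<Rightarrow> real \<Rightarrow> real \<Rightarrow> real" where
  "jacobi_phi j a b x =
     jacobiP j a b x * (1 - x) powr (a / 2) * (1 + x) powr (b / 2) / sqrt (jacobi_h j a b)"

definition jacobi_kernel :: "nat \<Rightarrow> real \<Rightarrow> real \<Rightarrow> real \<Rightarrow> real \<Rightarrow> real" where
  "jacobi_kernel N a b x y = (\<Sum>j<N. jacobi_phi j a b x * jacobi_phi j a b y)"

definition sine_kernel :: "real \<Rightarrow> real \<Rightarrow> real" where
  "sine_kernel x y = (if x = y then 1 / pi else sin (x - y) / (pi * (x - y)))"

end

theory Submission
  imports Defs "HOL-Computational_Algebra.Formal_Power_Series" "HOL-Real_Asymp.Real_Asymp"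
begin

text \<open>
  By Christoffel--Darboux, the kernel is a cross term \<open>F x * G y - G x * F y\<close> divided by \<open>x - y\<close>, where
  \<open>F\<close> and \<open>G\<close> are the weighted polynomials of degrees \<open>N\<close> and \<open>N - 1\<close> at argument \<open>t / N\<close>. The structure
  relations of the Jacobi polynomials turn \<open>(F, G)\<close> into a solution of a first-order system that is an
  \<open>O(1/N)\<close> perturbation of the rotation \<open>F' = G\<close>, \<open>G' = -F\<close>, so the cross term is
  \<open>(F(0)\<^sup>2 + G(0)\<^sup>2) * sin (x - y)\<close> up to an error \<open>O(|x - y| / N)\<close>; the factor \<open>|x - y|\<close> absorbs the
  division.

  It remains to find the energy \<open>F(0)\<^sup>2 + G(0)\<^sup>2\<close>. At the origin the normalised three-term recurrence is
  \<open>p\<^sub>n\<^sub>+\<^sub>1 + p\<^sub>n\<^sub>-\<^sub>1 = O(n\<^sup>-\<^sup>2)\<close>, which gives convergence of the energy with rate \<open>O(1/n)\<close>. The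
  limit comes from \<open>2\<^sup>n P\<^sub>n(0) = [z\<^sup>n] (1 - z\<^sup>2)\<^sup>n\<^sup>-\<^sup>1 g(z)\<close> with
  \<open>g(z) = (1 + z)\<^sup>a\<^sup>+\<^sup>1 (1 - z)\<^sup>b\<^sup>+\<^sup>1\<close>: by Tannery's theorem and the central binomial asymptotics only
  \<open>|g(\<i>)|\<^sup>2 = 2\<^sup>a\<^sup>+\<^sup>b\<^sup>+\<^sup>2\<close> enters.
\<close>

section \<open>Structure relations\<close>

text \<open>For \<open>a\<close> or \<open>b\<close> in \<open>(-1, 0)\<close> the binomial
  coefficients with that upper entry are not absolutely summable. Taking out only the power
  \<open>n - 1\<close> of \<open>1 - z^2\<close>, and not \<open>n\<close>, leaves the positive
  exponents \<open>a + 1\<close> and \<open>b + 1\<close> in \<open>g\<close>; this makes the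
  coefficients of \<open>g\<close> absolutely summable and allows evaluation on the unit circle.

  As \<open>1 - z^2\<close> is even, odd degrees see only the odd coefficients of \<open>g\<close>
  and even degrees only the even ones, that is, the imaginary and the real part of
  \<open>g(\<i>)\<close>. A single value at the origin therefore depends on the argument of
  \<open>g(\<i>)\<close>, while the energy of two consecutive degrees depends on the modulus alone.

  Tannery's theorem gives the limit without a rate, the recurrence gives a rate without naming the
  limit; the proof combines them. The bound off the diagonal does not deteriorate as
  \<open>y\<close> approaches \<open>x\<close>, so the diagonal follows by continuity and no
  confluent Christoffel--Darboux formula enters.\<close>

definition jacobi_coeff :: "real \<Rightarrow> real \<Rightarrow> nat \<Rightarrow> nat \<Rightarrow> real" where
  "jacobi_coeff a b n s = ((real n + a) gchoose (n - s)) * ((real n + b) gchoose s)"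

text \<open>As \<open>(x + 1) / 2 - (x - 1) / 2 = 1\<close>, identities between Jacobi polynomials of different degrees can be
  made homogeneous in these two quantities and then be verified coefficientwise.\<close>

definition homog :: "(nat \<Rightarrow> real) \<Rightarrow> nat \<Rightarrow> real \<Rightarrow> real \<Rightarrow> real" where
  "homog T n u v = (\<Sum>s\<le>n. T s * u ^ s * v ^ (n - s))"

lemma jacobiP_eq_homog:
  "jacobiP n a b x = homog (jacobi_coeff a b n) n ((x - 1) / 2) ((x + 1) / 2)"
  by (simp add: jacobiP_def homog_def jacobi_coeff_def)

lemma homog_mult_fst:
  "u * homog T n u v = homog (\<lambda>s. case s of 0 \<Rightarrow> 0 | Suc r \<Rightarrow> T r) (Suc n) u v"
  by (simp add: homog_def sum.atMost_Suc_shift sum_distrib_left mult_ac del: sum.atMost_Suc)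

text \<open>Multiplying by \<open>v\<close> creates no term \<open>u ^ Suc n\<close>; the cut-off
  records this, since nothing is known about \<open>T (Suc n)\<close>.\<close>

lemma homog_mult_snd:
  "v * homog T n u v = homog (\<lambda>s. if s \<le> n then T s else 0) (Suc n) u v"
  by (auto simp: homog_def sum_distrib_left mult_ac Suc_diff_le intro!: sum.cong)

lemma homog_add: "homog S n u v + homog T n u v = homog (\<lambda>s. S s + T s) n u v"
  by (simp add: homog_def sum.distrib algebra_simps)

lemma homog_diff: "homog S n u v - homog T n u v = homog (\<lambda>s. S s - T s) n u v"
  by (simp add: homog_def sum_subtractf algebra_simps)

lemma homog_cmult: "k * homog T n u v = homog (\<lambda>s. k * T s) n u v"
  by (simp add: homog_def sum_distrib_left algebra_simps)

lemma homog_cong: "(\<And>s. s \<le> n \<Longrightarrow> S s = T s) \<Longrightarrow> homog S n u v = homog T n u v"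
  by (simp add: homog_def)

section \<open>Derivatives in homogeneous form and ratios of coefficients\<close>

definition jacobi_deriv :: "nat \<Rightarrow> real \<Rightarrow> real \<Rightarrow> real \<Rightarrow> real" where
  "jacobi_deriv n a b x = deriv (jacobiP n a b) x"

lemma homog_has_derivative:
  "((\<lambda>x. homog T n ((x - 1) / 2) ((x + 1) / 2)) has_real_derivative
     (\<Sum>s\<le>n. T s * (real s * ((x - 1) / 2) ^ (s - 1) * ((x + 1) / 2) ^ (n - s)
               + real (n - s) * ((x - 1) / 2) ^ s * ((x + 1) / 2) ^ (n - s - 1)) / 2)) (at x)"
  unfolding homog_def
  by (rule derivative_eq_intros refl sum.cong | simp add: algebra_simps add_divide_distrib
    diff_divide_distrib)+

lemma jacobiP_has_derivative:
  "(jacobiP n a b has_real_derivative jacobi_deriv n a b x) (at x)"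
proof -
  have "\<exists>D. (jacobiP n a b has_real_derivative D) (at x)"
    unfolding jacobiP_eq_homog[abs_def] using homog_has_derivative by blast
  thus ?thesis
    by (auto simp: jacobi_deriv_def DERIV_imp_deriv)
qed

text \<open>Differentiation loses a power of \<open>u\<close> or of \<open>v\<close>, but
  \<open>1 - x^2 = - 4 * u * v\<close> restores it, so the product is again a form, of degree
  \<open>n + 1\<close>.\<close>

lemma jacobi_deriv_eq_homog:
  fixes x :: real
  defines "u \<equiv> (x - 1) / 2" and "v \<equiv> (x + 1) / 2"
  shows "(1 - x\<^sup>2) * jacobi_deriv n a b x =
    -2 * (v * homog (\<lambda>s. real s * jacobi_coeff a b n s) n u v
        + u * homog (\<lambda>s. (real n - real s) * jacobi_coeff a b n s) n u v)"
proof -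
  have "jacobi_deriv n a b x = (\<Sum>s\<le>n. jacobi_coeff a b n s * (real s * u ^ (s - 1) * v ^ (n - s)
               + real (n - s) * u ^ s * v ^ (n - s - 1)) / 2)"
    using DERIV_unique[OF jacobiP_has_derivative homog_has_derivative[of "jacobi_coeff a b n" n x,
          folded jacobiP_eq_homog]] by (simp add: u_def v_def)
  moreover have "1 - x\<^sup>2 = - 4 * u * v"
    by (simp add: u_def v_def field_simps power2_eq_square)
  ultimately have "(1 - x\<^sup>2) * jacobi_deriv n a b x = (\<Sum>s\<le>n. jacobi_coeff a b n s *
      (-2) * (real s * (u * u ^ (s - 1)) * v * v ^ (n - s) + real (n - s) * (v * v ^ (n - s -
        1)) * u * u ^ s))"
    by (simp only: sum_distrib_left, intro sum.cong refl) (simp add: field_simps)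
  also have "\<dots> = (\<Sum>s\<le>n. jacobi_coeff a b n s *
      (-2) * (real s * u ^ s * v * v ^ (n - s) + (real n - real s) * v ^ (n - s) * u * u ^ s))"
  proof (intro sum.cong refl)
    fix s assume "s \<in> {..n}"
    \<comment> \<open>Where the exponents \<open>s - 1\<close> and \<open>n - s - 1\<close> are
      truncated, the factor in front of them is 0.\<close>
    have "real s * (u * u ^ (s - 1)) = real s * u ^ s"
      by (cases s) auto
    moreover have "real (n - s) * (v * v ^ (n - s - 1)) = (real n - real s) * v ^ (n - s)"
      using \<open>s \<in> {..n}\<close> by (cases "n - s") (auto simp: of_nat_diff)
    ultimately show "jacobi_coeff a b n s *
      (-2) * (real s * (u * u ^ (s - 1)) * v * v ^ (n - s) + real (n - s) * (v * v ^ (n - s -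
        1)) * u * u ^ s)
      = jacobi_coeff a b n s *
      (-2) * (real s * u ^ s * v * v ^ (n - s) + (real n - real s) * v ^ (n - s) * u * u ^ s)"
      by (simp only:)
  qed
  also have "\<dots> = -2 * (v * homog (\<lambda>s. real s * jacobi_coeff a b n s) n u v
        + u * homog (\<lambda>s. (real n - real s) * jacobi_coeff a b n s) n u v)"
    by (simp only: homog_def sum_distrib_left sum.distrib[symmetric], intro sum.cong refl)
       (simp add: algebra_simps)
  finally show ?thesis .
qed

text \<open>Each of the two binomial factors changes by an absorption identity, and the two
  identities are multiplied. Together with the next two lemmas this expresses all neighbouring
  coefficients as rational multiples of \<open>jacobi_coeff a b m r\<close>, as the comparison of
  coefficients in the structure relations requires.\<close>

lemma jacobi_coeff_Suc_Suc:
  assumes "r \<le> m"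
  shows "jacobi_coeff a b (Suc m) (Suc r) * ((real r + a + 1) * (real r + 1)) =
         jacobi_coeff a b m r * ((real m + a + 1) * (real m + b + 1))"
proof -
  have 1: "(real r + a + 1) * (real m + a + 1 gchoose (m - r)) =
    (real m + a + 1) * (real m + a gchoose (m - r))"
    using gbinomial_absorb_comp[of "real m + a + 1" "m - r"] assms
      by (simp add: of_nat_diff algebra_simps)
  have 2: "(real r + 1) * (real m + b + 1 gchoose Suc r) =
    (real m + b + 1) * (real m + b gchoose r)"
    using gbinomial_absorption[of r "real m + b + 1"] by (simp add: add_ac)
  show ?thesis
    using arg_cong2[OF 1 2, of "(*)"] by (simp add: jacobi_coeff_def mult_ac add_ac)
qed

lemma jacobi_coeff_Suc:
  assumes "r \<le> m"
  shows "jacobi_coeff a b (Suc m) r * ((real m - real r + 1) * (real m - real r + b + 1)) =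
         jacobi_coeff a b m r * ((real m + a + 1) * (real m + b + 1))"
proof -
  have 1: "(real m - real r + 1) * (real m + a + 1 gchoose Suc (m - r)) =
    (real m + a + 1) * (real m + a gchoose (m - r))"
    using gbinomial_absorption[of "m - r" "real m + a + 1"] assms
      by (simp add: of_nat_diff algebra_simps)
  have 2: "(real m - real r + b + 1) * (real m + b + 1 gchoose r) =
    (real m + b + 1) * (real m + b gchoose r)"
    using gbinomial_absorb_comp[of "real m + b + 1" r] by (simp add: algebra_simps)
  show ?thesis
    using arg_cong2[OF 1 2, of "(*)"] assms
      by (simp add: jacobi_coeff_def mult_ac add_ac Suc_diff_le)
qed

lemma jacobi_coeff_next:
  assumes "r < m"
  shows "jacobi_coeff a b m (Suc r) * ((real r + a + 1) * (real r + 1)) =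
         jacobi_coeff a b m r * ((real m - real r) * (real m - real r + b))"
proof -
  obtain k where k: "m - r = Suc k" using assms by (cases "m - r") auto
  hence k': "m - Suc r = k" "real k = real m - real r - 1" by auto
  have 1: "(real r + a + 1) * (real m + a gchoose k) =
    (real m - real r) * (real m + a gchoose Suc k)"
    using gbinomial_mult_1[of "real m + a" k] k' by (simp add: algebra_simps)
  have 2: "(real r + 1) * (real m + b gchoose Suc r) =
    (real m - real r + b) * (real m + b gchoose r)"
    using gbinomial_mult_1[of "real m + b" r] by (simp add: algebra_simps)
  show ?thesis
    using arg_cong2[OF 1 2, of "(*)"] by (simp add: jacobi_coeff_def k k' mult_ac add_ac)
qed

section \<open>The two structure relations\<close>

context
  fixes a b :: real
  assumes ab: "a > -1" "b > -1"
begin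

text \<open>Because \<open>v - u = 1\<close>, one factor \<open>v - u\<close> can be inserted next
  to \<open>a - b\<close> and two next to the polynomial of degree \<open>m\<close>. Both sides are
  then forms of degree \<open>n + 1\<close> in \<open>u\<close> and \<open>v\<close>, and it
  suffices to compare coefficients.\<close>

lemma jacobi_structure_lower:
  fixes m :: nat and x :: real
  defines "n \<equiv> Suc m"
  defines "c \<equiv> 2 * real n + a + b"
  shows "c * ((1 - x\<^sup>2) * jacobi_deriv n a b x) =
     real n * (a - b - c * x) * jacobiP n a b x + 2 * (real n + a) * (real n + b) * jacobiP m a b x"
proof -
  define u v where "u = (x - 1) / 2" and "v = (x + 1) / 2"
  have one: "v - u = 1" and x: "x = v + u" by (simp_all add: u_def v_def field_simps)
  let ?T = "jacobi_coeff a b n" and ?T' = "jacobi_coeff a b m"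
  define H where "H = homog ?T n u v"
  define H' where "H' = homog ?T' m u v"
  have "c * ((1 - x\<^sup>2) * jacobi_deriv n a b x) =
    c * (-2 * (v * homog (\<lambda>s. real s * ?T s) n u v + u * homog (\<lambda>s. (real n -
      real s) * ?T s) n u v))"
    unfolding jacobi_deriv_eq_homog u_def v_def ..
  also have "\<dots> = real n * ((a - b) * (v * H - u * H) - c * (v * H + u * H)) +
       (2 * (real n + a) * (real n + b)) * (v * (v * H' - u * H') - u * (v * H' - u * H'))"
    unfolding H_def H'_def homog_mult_fst homog_mult_snd homog_add homog_diff homog_cmult n_def
  proof (intro homog_cong, goal_cases)
    case (1 s)
    \<comment> \<open>At the two extreme indices all but one coefficient of each degree is missing,
      and a single absorption identity is enough; the interior indices need all the ratios.\<close>
    consider "s = 0" | r where "s = Suc r" "r \<le> m" | "s = Suc (Suc m)"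
      using 1 by (cases s) (auto simp: le_Suc_eq)
    thus ?case
    proof cases
      case 1
      have "jacobi_coeff a b n 0 * (real m + 1) = jacobi_coeff a b m 0 * (real m + a + 1)"
        using gbinomial_absorption[of m "real m + a + 1"]
        by (simp add: jacobi_coeff_def n_def algebra_simps)
      hence "jacobi_coeff a b n 0 * (real m + 1) * (real m + b + 1) =
        jacobi_coeff a b m 0 * (real m + a + 1) * (real m + b + 1)"
        by simp
      then show ?thesis using 1 by (simp add: c_def n_def algebra_simps)
    next
      case (2 r)
      define p where "p = (real r + a + 1) * (real r + 1)"
      define q where "q = (real m - real r + 1) * (real m - real r + b + 1)"
      \<comment> \<open>A common measure: every coefficient that occurs is \<open>K\<close> times a
        polynomial in \<open>r\<close>, \<open>m\<close>, \<open>a\<close> and \<open>b\<close>, so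
        the claim becomes a polynomial identity.\<close>
      define K where "K = jacobi_coeff a b m r / (p * q)"
      have pq: "p > 0" "q > 0" using ab 2 unfolding p_def q_def by (auto intro!: mult_pos_pos)
      let ?w = "(real m + a + 1) * (real m + b + 1)"
      have X: "jacobi_coeff a b m r = K * p * q" using pq by (simp add: K_def)
      have T1: "jacobi_coeff a b (Suc m) (Suc r) = K * q * ?w"
        using jacobi_coeff_Suc_Suc[OF 2(2), of a b, folded p_def] pq X by simp
      have T2: "jacobi_coeff a b (Suc m) r = K * p * ?w"
        using jacobi_coeff_Suc[OF 2(2), of a b, folded q_def] pq X by simp
      have T3: "(if Suc r \<le> m then jacobi_coeff a b m (Suc r) else 0) =
        K * q * (real m - real r) * (real m - real r + b)"
        using jacobi_coeff_next[of r m a b, folded p_def] pq X 2 by auto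
      have T4: "(case r of 0 \<Rightarrow> 0 | Suc k \<Rightarrow> jacobi_coeff a b m k) = K * p * (real r + a) * real r"
      proof (cases r)
        case (Suc k)
        hence k: "k < m" using 2 by simp
        have "jacobi_coeff a b m r * ((real r + a) * real r) = jacobi_coeff a b m k * q"
          using jacobi_coeff_next[OF k, of a b] Suc by (simp add: q_def algebra_simps)
        then show ?thesis using pq Suc unfolding X by simp
      qed auto
      have n_r: "(if Suc r \<le> Suc m then t else 0) = t" for t :: real using 2 by simp
      have n_r': "(if r \<le> m then t else 0) = t" for t :: real using 2 by simp
      show ?thesis
        unfolding 2(1) nat.case T3 T4 T1 T2 X n_r n_r' p_def q_def c_def n_def of_nat_Suc
        by algebra
    next
      case 3
      have "jacobi_coeff a b n n * (real m + 1) = jacobi_coeff a b m m * (real m + b + 1)"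
        using gbinomial_absorption[of m "real m + b + 1"]
        by (simp add: jacobi_coeff_def n_def algebra_simps)
      hence "jacobi_coeff a b n n * (real m + 1) * (real m + a + 1) =
        jacobi_coeff a b m m * (real m + b + 1) * (real m + a + 1)"
        by simp
      then show ?thesis using 3 by (simp add: c_def n_def algebra_simps)
    qed
  qed
  also have "\<dots> = real n * ((a - b) * (v - u) - c * x) * H +
       (2 * (real n + a) * (real n + b)) * (v - u)\<^sup>2 * H'"
    by (simp add: x power2_eq_square algebra_simps)
  finally show ?thesis unfolding one by (simp add: H_def H'_def jacobiP_eq_homog u_def v_def)
qed

text \<open>The companion relation for the derivative of the lower degree. Both sides are forms of
  degree \<open>m + 1\<close> once \<open>a - b\<close> carries a factor \<open>v - u\<close>. The
  top index needs no case of its own, because \<open>real m - real r\<close> vanishes there.\<close>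

lemma jacobi_structure_upper:
  fixes m :: nat and x :: real
  defines "n \<equiv> Suc m"
  defines "c \<equiv> 2 * real n + a + b"
  shows "c * ((1 - x\<^sup>2) * jacobi_deriv m a b x) =
     (real n + a + b) * ((a - b + c * x) * jacobiP m a b x - 2 * real n * jacobiP n a b x)"
proof -
  define u v where "u = (x - 1) / 2" and "v = (x + 1) / 2"
  have one: "v - u = 1" and x: "x = v + u" by (simp_all add: u_def v_def field_simps)
  let ?T = "jacobi_coeff a b n" and ?T' = "jacobi_coeff a b m"
  define H where "H = homog ?T n u v"
  define H' where "H' = homog ?T' m u v"
  have "c * ((1 - x\<^sup>2) * jacobi_deriv m a b x) =
    c * (-2 * (v * homog (\<lambda>s. real s * ?T' s) m u v + u * homog (\<lambda>s. (real m -
      real s) * ?T' s) m u v))"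
    unfolding jacobi_deriv_eq_homog u_def v_def ..
  also have "\<dots> = (real n + a + b) * (((a - b) * (v * H' - u * H') + c * (v * H' + u * H'))
        - (2 * real n) * H)"
    unfolding H_def H'_def homog_mult_fst homog_mult_snd homog_add homog_diff homog_cmult n_def
  proof (intro homog_cong, goal_cases)
    case (1 s)
    consider "s = 0" | r where "s = Suc r" "r \<le> m"
      using 1 by (cases s) auto
    thus ?case
    proof cases
      case 1
      have "jacobi_coeff a b n 0 * (real m + 1) = jacobi_coeff a b m 0 * (real m + a + 1)"
        using gbinomial_absorption[of m "real m + a + 1"]
        by (simp add: jacobi_coeff_def n_def algebra_simps)
      hence "jacobi_coeff a b n 0 * (real m + 1) * (real m + 1 + a + b) =
        jacobi_coeff a b m 0 * (real m + a + 1) * (real m + 1 + a + b)"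
        by simp
      then show ?thesis using 1 by (simp add: c_def n_def algebra_simps)
    next
      case (2 r)
      define p where "p = (real r + a + 1) * (real r + 1)"
      define K where "K = jacobi_coeff a b m r / p"
      have pq: "p > 0" using ab 2 unfolding p_def by (auto intro!: mult_pos_pos)
      let ?w = "(real m + a + 1) * (real m + b + 1)"
      have X: "jacobi_coeff a b m r = K * p" using pq by (simp add: K_def)
      have T1: "jacobi_coeff a b (Suc m) (Suc r) = K * ?w"
        using jacobi_coeff_Suc_Suc[OF 2(2), of a b, folded p_def] pq X by simp
      have T3: "(if Suc r \<le> m then jacobi_coeff a b m (Suc r) else 0) =
        K * (real m - real r) * (real m - real r + b)"
        using jacobi_coeff_next[of r m a b, folded p_def] pq X 2 by auto
      have if_mult: "(if Suc r \<le> m then t * jacobi_coeff a b m (Suc r) else 0)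
          = t * (if Suc r \<le> m then jacobi_coeff a b m (Suc r) else 0)" for t by simp
      show ?thesis
        unfolding 2(1) nat.case if_mult T3 T1 X p_def c_def n_def of_nat_Suc
        by algebra
    qed
  qed
  also have "\<dots> = (real n + a + b) * (((a - b) * (v - u) + c * x) * H' - 2 * real n * H)"
    by (simp add: x algebra_simps)
  finally show ?thesis unfolding one by (simp add: H_def H'_def jacobiP_eq_homog u_def v_def)
qed

end

section \<open>Three-term recurrence and Christoffel--Darboux formula\<close>

lemma Gamma_real_plus1: "(t::real) > 0 \<Longrightarrow> Gamma (t + 1) = t * Gamma t"
  by (intro Gamma_plus1) (auto elim!: nonpos_Ints_cases)

text \<open>For \<open>a + b = -1\<close> the quotient defining \<open>rec_up a b 0\<close> is \<open>0 / 0\<close>, so degree \<open>0\<close> is treated separately below.\<close>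

definition rec_up :: "real \<Rightarrow> real \<Rightarrow> nat \<Rightarrow> real" where
  "rec_up a b n = 2 * (real n + 1) * (real n + 1 + a + b) / ((2 * real n + a + b +
    2) * (2 * real n + a + b + 1))"

definition rec_mid :: "real \<Rightarrow> real \<Rightarrow> nat \<Rightarrow> real" where
  "rec_mid a b n = (b\<^sup>2 - a\<^sup>2) / ((2 * real n + a + b) * (2 * real n + a + b + 2))"

definition rec_down :: "real \<Rightarrow> real \<Rightarrow> nat \<Rightarrow> real" where
  "rec_down a b n = 2 * (real n + a) * (real n + b) / ((2 * real n + a + b) * (2 * real n + a +
    b + 1))"

context
  fixes a b :: real
  assumes ab: "a > -1" "b > -1"
begin

lemma rec_up_pos: "n \<ge> 1 \<Longrightarrow> rec_up a b n > 0"
  and rec_down_pos: "n \<ge> 1 \<Longrightarrow> rec_down a b n > 0"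
  using ab by (auto simp: rec_up_def rec_down_def intro!: divide_pos_pos mult_pos_pos)

text \<open>The derivative of \<open>jacobiP n a b\<close> is expressed through degree
  \<open>n - 1\<close> by the lower relation and through degree \<open>n + 1\<close> by the upper
  one; eliminating it leaves three consecutive degrees.\<close>

lemma jacobi_recurrence:
  assumes "n \<ge> 1"
  shows "x * jacobiP n a b x = rec_up a b n * jacobiP (Suc n) a b x
           + rec_mid a b n * jacobiP n a b x + rec_down a b n * jacobiP (n - 1) a b x"
proof -
  obtain m where m: "n = Suc m" using assms by (cases n) auto
  define c where "c = 2 * real n + a + b"
  have c: "c > 0" using ab m by (simp add: c_def)
  define D where "D = (1 - x\<^sup>2) * jacobi_deriv n a b x"
  define P0 P1 P2 where "P0 = jacobiP m a b x" and "P1 = jacobiP n a b x" and "P2 =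
    jacobiP (Suc n) a b x"
  have A: "c * D = real n * (a - b - c * x) * P1 + 2 * (real n + a) * (real n + b) * P0"
    using jacobi_structure_lower[OF ab, of m x] by (simp only: c_def D_def P0_def P1_def m)
  have B: "(c + 2) * D = (real n + 1 + a + b) * ((a - b + (c + 2) * x) * P1 - 2 * (real n +
    1) * P2)"
    using jacobi_structure_upper[OF ab, of n x]
      by (simp add: c_def D_def P1_def P2_def algebra_simps)
  have "(c + 2) * (real n * (a - b - c * x) * P1 + 2 * (real n + a) * (real n + b) * P0) =
      c * ((real n + 1 + a + b) * ((a - b + (c + 2) * x) * P1 - 2 * (real n + 1) * P2))"
    by (simp only: A[symmetric] B[symmetric] mult.left_commute)
  hence key: "c * (c + 2) * (c + 1) * x * P1 = 2 * (real n + 1) * (real n + 1 + a + b) * c * P2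
        + (b\<^sup>2 - a\<^sup>2) * (c + 1) * P1 + 2 * (real n + a) * (real n + b) * (c + 2) * P0"
    unfolding c_def by algebra
  have "x * P1 = (c * (c + 2) * (c + 1) * x * P1) / (c * (c + 2) * (c + 1))"
    using c by simp
  also have "\<dots> = rec_up a b n * P2 + rec_mid a b n * P1 + rec_down a b n * P0"
    unfolding key rec_up_def rec_mid_def rec_down_def c_def[symmetric]
    using c by (simp add: add_divide_distrib mult.assoc)
  finally show ?thesis by (simp add: P0_def P1_def P2_def m)
qed

lemma jacobi_h_pos: "jacobi_h n a b > 0"
proof (cases n)
  case 0
  thus ?thesis using ab by (auto simp: jacobi_h_def intro!: divide_pos_pos mult_pos_pos
    Gamma_real_pos)
next
  case (Suc m)
  thus ?thesis using ab
    by (auto simp: jacobi_h_def intro!: divide_pos_pos mult_pos_pos Gamma_real_pos)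
qed

text \<open>This is the symmetry of the recurrence after normalisation by \<open>jacobi_h\<close>.
  It makes the Christoffel--Darboux sum telescope and later identifies the off-diagonal entries of
  the Jacobi matrix.\<close>

lemma jacobi_h_Suc:
  assumes "n \<ge> 1"
  shows "rec_up a b n / jacobi_h n a b = rec_down a b (Suc n) / jacobi_h (Suc n) a b"
proof -
  define c where "c = 2 * real n + a + b"
  have c: "c > 0" using ab assms by (simp add: c_def)
  have n: "real n \<ge> 1" using assms by simp
  have pos: "real n + a + 1 > 0" "real n + b + 1 > 0" "real n + a + b + 1 > 0"
    using ab n by linarith+
  have h1: "jacobi_h (Suc n) a b =
    2 powr (a + b + 1) * ((real n + a + 1) * Gamma (real n + a + 1)) *
      ((real n + b + 1) * Gamma (real n + b + 1))
       / ((real n + 1) * fact n * (c + 3) * ((real n + a + b + 1) * Gamma (real n + a + b + 1)))"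
    using Gamma_real_plus1[OF pos(1)] Gamma_real_plus1[OF pos(2)] Gamma_real_plus1[OF pos(3)]
      by (simp add: jacobi_h_def c_def algebra_simps)
  have h0: "jacobi_h n a b = 2 powr (a + b + 1) * Gamma (real n + a + 1) * Gamma (real n + b + 1)
           / (fact n * (c + 1) * Gamma (real n + a + b + 1))"
    using assms by (simp add: jacobi_h_def c_def)
  have u: "rec_up a b n = 2 * (real n + 1) * (real n + a + b + 1) / ((c + 2) * (c + 1))"
    by (simp add: rec_up_def c_def add_ac)
  have d: "rec_down a b (Suc n) = 2 * (real n + a + 1) * (real n + b + 1) / ((c + 2) * (c + 3))"
    by (simp add: rec_down_def c_def algebra_simps)
  have nz: "2 powr (a + b + 1) > (0::real)" "Gamma (real n + a + 1) > 0" "Gamma (real n +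
    b + 1) > 0"
     "Gamma (real n + a + b + 1) > 0" using pos by (auto intro: Gamma_real_pos)
  show ?thesis
    unfolding h0 h1 u d using c pos nz n by (simp add: divide_simps) (simp add: algebra_simps)
qed

text \<open>The same symmetry in degree 0, with the quotient for \<open>rec_up a b 0\<close>
  cancelled to \<open>2 / (a + b + 2)\<close>, which is also meaningful for
  \<open>a + b = -1\<close>.\<close>

lemma jacobi_h_0: "1 / jacobi_h 0 a b = (a + b + 2) / 2 * (rec_down a b 1 / jacobi_h 1 a b)"
proof -
  have h1: "jacobi_h 1 a b =
    2 powr (a + b + 1) * ((a + 1) * Gamma (a + 1)) * ((b + 1) * Gamma (b + 1))
       / ((a + b + 3) * Gamma (a + b + 2))"
    using Gamma_real_plus1[of "a + 1"] Gamma_real_plus1[of "b + 1"] ab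
      by (simp add: jacobi_h_def algebra_simps)
  have d: "rec_down a b 1 = 2 * (a + 1) * (b + 1) / ((a + b + 2) * (a + b + 3))"
    by (simp add: rec_down_def algebra_simps)
  have nz: "2 powr (a + b + 1) > (0::real)" "Gamma (a + 1) > 0" "Gamma (b + 1) > 0"
     "Gamma (a + b + 2) > 0" "a + 1 > 0" "b + 1 > 0" "a + b + 2 > 0" "a + b + 3 > 0" using ab
       by (auto intro: Gamma_real_pos)
  have h0: "jacobi_h 0 a b = 2 powr (a + b + 1) * Gamma (a + 1) * Gamma (b + 1) / Gamma (a + b + 2)"
    by (simp add: jacobi_h_def)
  show ?thesis unfolding h0 h1 d using nz by (simp add: divide_simps)
qed

text \<open>Multiplying the recurrence at \<open>x\<close> by the polynomial at \<open>y\<close>,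
  and conversely, and subtracting cancels \<open>rec_mid\<close>; by \<open>jacobi_h_Suc\<close> the
  remaining differences telescope. The induction starts at \<open>N = 1\<close>, where the degree 1
  polynomial is linear with slope \<open>(a + b + 2) / 2\<close>.\<close>

lemma jacobi_christoffel_darboux:
  assumes "N \<ge> 1"
  shows "(x - y) * (\<Sum>j<N. jacobiP j a b x * jacobiP j a b y / jacobi_h j a b) =
     rec_down a b N / jacobi_h N a b *
       (jacobiP N a b x * jacobiP (N - 1) a b y - jacobiP (N - 1) a b x * jacobiP N a b y)"
  using assms
proof (induction N rule: dec_induct)
  case base
  have P1: "jacobiP 1 a b t = (a + b + 2) / 2 * t + (a - b) / 2" for t
    by (simp add: jacobiP_def field_simps)
  have P0: "jacobiP 0 a b t = 1" for t by (simp add: jacobiP_def)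
  have "(x - y) * (1 / jacobi_h 0 a b) =
     rec_down a b 1 / jacobi_h 1 a b * ((a + b + 2) / 2 * (x - y))"
    unfolding jacobi_h_0 by (simp add: mult_ac)
  moreover have "jacobiP 1 a b x - jacobiP 1 a b y = (a + b + 2) / 2 * (x - y)"
    unfolding P1 by (simp add: field_simps)
  ultimately have "(x - y) * (1 / jacobi_h 0 a b) =
     rec_down a b 1 / jacobi_h 1 a b * (jacobiP 1 a b x - jacobiP 1 a b y)"
    by (simp only:)
  then show ?case by (simp add: P0)
next
  case (step n)
  define p q where "p k = jacobiP k a b x" and "q k = jacobiP k a b y" for k
  define h where "h = jacobi_h n a b"
  have Rx: "x * p n = rec_up a b n * p (Suc n) + rec_mid a b n * p n + rec_down a b n * p (n - 1)"
    using jacobi_recurrence[OF step(1)] by (simp add: p_def)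
  have Ry: "y * q n = rec_up a b n * q (Suc n) + rec_mid a b n * q n + rec_down a b n * q (n - 1)"
    using jacobi_recurrence[OF step(1)] by (simp add: q_def)
  have "(x - y) * (p n * q n) = rec_up a b n * (p (Suc n) * q n - p n * q (Suc n))
      - rec_down a b n * (p n * q (n - 1) - p (n - 1) * q n)"
    using Rx Ry by algebra
  hence "(x - y) * (p n * q n / h) = rec_up a b n / h * (p (Suc n) * q n - p n * q (Suc n))
      - rec_down a b n / h * (p n * q (n - 1) - p (n - 1) * q n)"
    by (simp add: diff_divide_distrib)
  moreover have "rec_up a b n / h = rec_down a b (Suc n) / jacobi_h (Suc n) a b"
    using jacobi_h_Suc[OF step(1)] by (simp add: h_def)
  ultimately have "(x - y) * (p n * q n / h) = rec_down a b (Suc n) / jacobi_h (Suc n) a b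
      * (p (Suc n) * q n - p n * q (Suc n)) - rec_down a b n / h * (p n * q (n - 1) - p (n -
        1) * q n)"
    by (simp only:)
  thus ?case using step(3)
    by (simp add: distrib_left p_def q_def h_def)
qed

end

section \<open>Perturbed rotations\<close>

text \<open>The exact rotation conserves \<open>F^2 + G^2\<close>. Under the perturbation its
  derivative is at most \<open>4 * e\<close> times itself, so Gronwall's argument bounds it, and the
  mean value inequality then bounds its drift from the value at 0.\<close>

lemma perturbed_rotation_energy_bound:
  fixes F G F' G' :: "real \<Rightarrow> real" and e R :: real
  assumes F: "\<And>t. \<bar>t\<bar> \<le> R \<Longrightarrow> (F has_real_derivative F' t) (at t)"
    and G: "\<And>t. \<bar>t\<bar> \<le> R \<Longrightarrow> (G has_real_derivative G' t) (at t)"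
    and F': "\<And>t. \<bar>t\<bar> \<le> R \<Longrightarrow> \<bar>F' t - G t\<bar> \<le> e * (\<bar>F t\<bar> + \<bar>G t\<bar>)"
    and G': "\<And>t. \<bar>t\<bar> \<le> R \<Longrightarrow> \<bar>G' t + F t\<bar> \<le> e * (\<bar>F t\<bar> + \<bar>G t\<bar>)"
    and e: "0 \<le> e" "e \<le> 1" and t: "\<bar>t\<bar> \<le> R"
  shows "(F t)\<^sup>2 + (G t)\<^sup>2 \<le> exp (4 * R) * ((F 0)\<^sup>2 + (G 0)\<^sup>2)"
    and "\<bar>(F t)\<^sup>2 + (G t)\<^sup>2 - ((F 0)\<^sup>2 + (G 0)\<^sup>2)\<bar> \<le> 4 * e * R * exp (4 * R) * ((F 0)\<^sup>2 + (G 0)\<^sup>2)"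
proof -
  define M where "M s = (F s)\<^sup>2 + (G s)\<^sup>2" for s
  define M' where "M' s = 2 * F s * F' s + 2 * G s * G' s" for s
  have M: "(M has_real_derivative M' s) (at s)" if "\<bar>s\<bar> \<le> R" for s
    unfolding M_def M'_def
    by (rule derivative_eq_intros F[OF that] G[OF that] refl | simp)+
  have M': "\<bar>M' s\<bar> \<le> 4 * e * M s" if "\<bar>s\<bar> \<le> R" for s
  proof -
    have "M' s = 2 * (F s * (F' s - G s) + G s * (G' s + F s))"
      by (simp add: M'_def algebra_simps)
    also have "\<bar>\<dots>\<bar> \<le> 2 * (\<bar>F s\<bar> * \<bar>F' s - G s\<bar> + \<bar>G s\<bar> * \<bar>G' s + F s\<bar>)"
      by (simp add: abs_mult[symmetric])
    also have "\<dots> \<le> 2 * (\<bar>F s\<bar> * (e * (\<bar>F s\<bar> + \<bar>G s\<bar>)) + \<bar>G s\<bar> * (e * (\<bar>F s\<bar> + \<bar>G s\<bar>)))"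
      using F'[OF that] G'[OF that] by (intro mult_left_mono add_mono) auto
    also have "\<dots> = 2 * e * (\<bar>F s\<bar> + \<bar>G s\<bar>)\<^sup>2"
      by (simp add: power2_eq_square algebra_simps)
    also have "\<dots> \<le> 2 * e * (2 * M s)"
    proof (intro mult_left_mono)
      have "0 \<le> (\<bar>F s\<bar> - \<bar>G s\<bar>)\<^sup>2" by simp
      thus "(\<bar>F s\<bar> + \<bar>G s\<bar>)\<^sup>2 \<le> 2 * M s"
        by (simp add: M_def power2_eq_square algebra_simps)
    qed (use e in auto)
    finally show ?thesis by simp
  qed
  have nonneg: "M s \<ge> 0" for s by (simp add: M_def)
  have bound: "M s \<le> exp (4 * R) * M 0" if s: "\<bar>s\<bar> \<le> R" for s
  proof -
    have "M s \<le> M 0 * exp (4 * e * \<bar>s\<bar>)"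
    proof (cases "s \<ge> 0")
      case True
      \<comment> \<open>The integrating factor makes the energy monotone; on the negative side it is
        used with the opposite sign.\<close>
      have "M s * exp (- 4 * e * s) \<le> M 0 * exp (- 4 * e * 0)"
      proof (rule DERIV_nonpos_imp_nonincreasing[OF True])
        fix r assume r: "0 \<le> r" "r \<le> s"
        have "((\<lambda>r. M r * exp (- 4 * e * r)) has_real_derivative
          (M' r - 4 * e * M r) * exp (- 4 * e * r)) (at r)"
          using r s by (auto intro!: derivative_eq_intros M simp: algebra_simps)
        moreover have "(M' r - 4 * e * M r) * exp (- 4 * e * r) \<le> 0"
          using M'[of r] r s by (intro mult_nonpos_nonneg) auto
        ultimately show "\<exists>y. ((\<lambda>r. M r * exp (- 4 * e * r)) has_real_derivative y) (at r) \<and> y \<le> 0"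
          by blast
      qed
      thus ?thesis using True by (simp add: exp_minus field_simps)
    next
      case False
      hence neg: "s \<le> 0" by simp
      have "M s * exp (4 * e * s) \<le> M 0 * exp (4 * e * 0)"
      proof (rule DERIV_nonneg_imp_nondecreasing[OF neg])
        fix r assume r: "s \<le> r" "r \<le> 0"
        have "((\<lambda>r. M r * exp (4 * e * r)) has_real_derivative
          (M' r + 4 * e * M r) * exp (4 * e * r)) (at r)"
          using r s by (auto intro!: derivative_eq_intros M simp: algebra_simps)
        moreover have "(M' r + 4 * e * M r) * exp (4 * e * r) \<ge> 0"
          using M'[of r] r s by (intro mult_nonneg_nonneg) auto
        ultimately show "\<exists>y. ((\<lambda>r. M r * exp (4 * e * r)) has_real_derivative y) (at r) \<and> y \<ge> 0"
          by blast
      qed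
      thus ?thesis using False by (simp add: exp_minus field_simps)
    qed
    also have "\<dots> \<le> M 0 * exp (4 * R)"
    proof (intro mult_left_mono nonneg)
      \<comment> \<open>The bound \<open>e \<le> 1\<close> removes \<open>e\<close> from the
        exponent, so that the constant depends on \<open>R\<close> alone.\<close>
      have "e * \<bar>s\<bar> \<le> 1 * R" using e s by (intro mult_mono) auto
      thus "exp (4 * e * \<bar>s\<bar>) \<le> exp (4 * R)" by simp
    qed
    finally show ?thesis by (simp add: mult_ac)
  qed
  from bound[OF t] show "(F t)\<^sup>2 + (G t)\<^sup>2 \<le> exp (4 * R) * ((F 0)\<^sup>2 + (G 0)\<^sup>2)"
    by (simp add: M_def)
  have R: "R \<ge> 0" using t by linarith
  have "norm (M t - M 0) \<le> (4 * e * (exp (4 * R) * M 0)) * norm (t - 0)"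
  proof (rule field_differentiable_bound[where S = "{-R..R}" and f' = M'])
    fix s assume "s \<in> {-R..R}"
    hence s: "\<bar>s\<bar> \<le> R" by auto
    show "(M has_real_derivative M' s) (at s within {-R..R})"
      using M[OF s] by (rule DERIV_subset) auto
    have "\<bar>M' s\<bar> \<le> 4 * e * M s" by (rule M'[OF s])
    also have "\<dots> \<le> 4 * e * (exp (4 * R) * M 0)"
      using bound[OF s] e by (intro mult_left_mono) auto
    finally show "norm (M' s) \<le> 4 * e * (exp (4 * R) * M 0)" by simp
  qed (use t R in auto)
  also have "\<dots> \<le> (4 * e * (exp (4 * R) * M 0)) * R"
    using t e nonneg[of 0] by (intro mult_left_mono) auto
  finally show "\<bar>(F t)\<^sup>2 + (G t)\<^sup>2 - ((F 0)\<^sup>2 + (G 0)\<^sup>2)\<bar> \<le>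
    4 * e * R * exp (4 * R) * ((F 0)\<^sup>2 + (G 0)\<^sup>2)"
    by (simp add: M_def mult_ac)
qed

text \<open>With \<open>y\<close> fixed, the cross product of the solution at \<open>s\<close> and
  at \<open>y\<close> vanishes for \<open>s = y\<close>, and it forms a perturbed rotation together
  with the inner product. Undoing this rotation leaves two nearly constant quantities. The factor
  \<open>\<bar>x - y\<bar>\<close> comes from the drift of the one and from the sine multiplying the
  other.\<close>

lemma perturbed_rotation_cross_bound:
  fixes F G F' G' :: "real \<Rightarrow> real" and e R :: real
  defines "M0 \<equiv> (F 0)\<^sup>2 + (G 0)\<^sup>2"
  assumes F: "\<And>t. \<bar>t\<bar> \<le> R \<Longrightarrow> (F has_real_derivative F' t) (at t)"
    and G: "\<And>t. \<bar>t\<bar> \<le> R \<Longrightarrow> (G has_real_derivative G' t) (at t)"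
    and F': "\<And>t. \<bar>t\<bar> \<le> R \<Longrightarrow> \<bar>F' t - G t\<bar> \<le> e * (\<bar>F t\<bar> + \<bar>G t\<bar>)"
    and G': "\<And>t. \<bar>t\<bar> \<le> R \<Longrightarrow> \<bar>G' t + F t\<bar> \<le> e * (\<bar>F t\<bar> + \<bar>G t\<bar>)"
    and e: "0 \<le> e" "e \<le> 1" and x: "\<bar>x\<bar> \<le> R" and y: "\<bar>y\<bar> \<le> R"
  shows "\<bar>F x * G y - G x * F y - M0 * sin (x - y)\<bar> \<le>
    4 * exp (4 * R) * (1 + 3 * R) * e * M0 * \<bar>x - y\<bar>"
proof -
  define B where "B = exp (4 * R) * M0"
  have R: "R \<ge> 0" using x by linarith
  have B: "B \<ge> 0" by (simp add: B_def M0_def)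
  note energy = perturbed_rotation_energy_bound[OF F G F' G' e]
  have sum_bound: "\<bar>F s\<bar> + \<bar>G s\<bar> \<le> sqrt (2 * B)" if "\<bar>s\<bar> \<le> R" for s
  proof (rule real_le_rsqrt)
    have "0 \<le> (\<bar>F s\<bar> - \<bar>G s\<bar>)\<^sup>2" by simp
    hence "(\<bar>F s\<bar> + \<bar>G s\<bar>)\<^sup>2 \<le> 2 * ((F s)\<^sup>2 + (G s)\<^sup>2)"
      by (simp add: power2_eq_square algebra_simps)
    also have "\<dots> \<le> 2 * B" using energy(1)[OF _ _ _ _ that] by (simp add: B_def M0_def)
    finally show "(\<bar>F s\<bar> + \<bar>G s\<bar>)\<^sup>2 \<le> 2 * B" .
  qed
  \<comment> \<open>\<open>S\<close> and \<open>C\<close> are cross and inner product with the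
    solution at \<open>y\<close>; \<open>P\<close> and \<open>Q\<close> are the errors in
    \<open>S' = C\<close> and \<open>C' = - S\<close>.\<close>
  define S where "S s = F s * G y - G s * F y" for s
  define C where "C s = F s * F y + G s * G y" for s
  define P where "P s = (F' s - G s) * G y - (G' s + F s) * F y" for s
  define Q where "Q s = (F' s - G s) * F y + (G' s + F s) * G y" for s
  have err: "\<bar>u * p + v * q\<bar> \<le> 2 * e * B"
    if s: "\<bar>s\<bar> \<le> R" and u: "\<bar>u\<bar> \<le> e * (\<bar>F s\<bar> + \<bar>G s\<bar>)" and v: "\<bar>v\<bar> \<le> e * (\<bar>F s\<bar> + \<bar>G s\<bar>)"
      and pq: "\<bar>p\<bar> + \<bar>q\<bar> = \<bar>F y\<bar> + \<bar>G y\<bar>" for s u v p q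
  proof -
    have "\<bar>u * p + v * q\<bar> \<le> \<bar>u\<bar> * \<bar>p\<bar> + \<bar>v\<bar> * \<bar>q\<bar>"
      using abs_triangle_ineq[of "u * p" "v * q"] by (simp add: abs_mult)
    also have "\<dots> \<le> e * (\<bar>F s\<bar> + \<bar>G s\<bar>) * \<bar>p\<bar> + e * (\<bar>F s\<bar> + \<bar>G s\<bar>) * \<bar>q\<bar>"
      using u v by (intro add_mono mult_right_mono) auto
    also have "\<dots> = e * ((\<bar>F s\<bar> + \<bar>G s\<bar>) * (\<bar>F y\<bar> + \<bar>G y\<bar>))"
      by (simp add: pq[symmetric] algebra_simps)
    also have "\<dots> \<le> e * (sqrt (2 * B) * sqrt (2 * B))"
      using sum_bound[OF s] sum_bound[OF y] e B by (intro mult_left_mono mult_mono) auto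
    also have "\<dots> = 2 * e * B" using B by simp
    finally show ?thesis .
  qed
  have P: "\<bar>P s\<bar> \<le> 2 * e * B" if "\<bar>s\<bar> \<le> R" for s
    using err[OF that F'[OF that] G'[OF that], of "G y" "- F y"] by (simp add: P_def)
  have Q: "\<bar>Q s\<bar> \<le> 2 * e * B" if "\<bar>s\<bar> \<le> R" for s
    using err[OF that F'[OF that] G'[OF that], of "F y" "G y"] by (simp add: Q_def)
  have trig: "\<bar>p * c1 + q * c2\<bar> \<le> 4 * e * B"
    if "\<bar>p\<bar> \<le> 2 * e * B" "\<bar>q\<bar> \<le> 2 * e * B" "\<bar>c1\<bar> \<le> 1" "\<bar>c2\<bar> \<le> 1"
    for p q c1 c2 :: real
  proof -
    have "\<bar>p * c1 + q * c2\<bar> \<le> \<bar>p\<bar> * \<bar>c1\<bar> + \<bar>q\<bar> * \<bar>c2\<bar>"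
      using abs_triangle_ineq[of "p * c1" "q * c2"] by (simp add: abs_mult)
    also have "\<dots> \<le> \<bar>p\<bar> * 1 + \<bar>q\<bar> * 1"
      using that by (intro add_mono mult_left_mono) auto
    finally show ?thesis using that by simp
  qed
  have dS: "(S has_real_derivative P s + C s) (at s)" if "\<bar>s\<bar> \<le> R" for s
    unfolding S_def P_def C_def
      by (auto intro!: derivative_eq_intros F[OF that] G[OF that] simp: algebra_simps)
  have dC: "(C has_real_derivative Q s - S s) (at s)" if "\<bar>s\<bar> \<le> R" for s
    unfolding S_def Q_def C_def
      by (auto intro!: derivative_eq_intros F[OF that] G[OF that] simp: algebra_simps)
  \<comment> \<open>The pair \<open>(S, C)\<close> rotated back by the angle \<open>s - y\<close>.
    The main terms cancel in the derivatives, which contain only \<open>P\<close> and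
    \<open>Q\<close>; moreover \<open>W y = 0\<close> and \<open>Z y\<close> is the energy at
    \<open>y\<close>.\<close>
  define W where "W s = S s * cos (s - y) - C s * sin (s - y)" for s
  define Z where "Z s = C s * cos (s - y) + S s * sin (s - y)" for s
  have W: "\<bar>W x - W y\<bar> \<le> (4 * e * B) * \<bar>x - y\<bar>"
  proof -
    have "norm (W x - W y) \<le> (4 * e * B) * norm (x - y)"
    proof (rule field_differentiable_bound[where S = "{-R..R}" and f' =
      "\<lambda>s. P s * cos (s - y) + Q s * (- sin (s - y))"])
      fix s assume "s \<in> {-R..R}"
      hence s: "\<bar>s\<bar> \<le> R" by auto
      show "(W has_real_derivative P s * cos (s - y) + Q s * (- sin (s - y))) (at s within {-R..R})"
        unfolding W_def
        by (rule DERIV_subset[of _ _ _ UNIV]) (auto intro!: derivative_eq_intros dS[OF s] dC[OF s]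
          simp: algebra_simps)
      show "norm (P s * cos (s - y) + Q s * (- sin (s - y))) \<le> 4 * e * B"
        unfolding real_norm_def by (rule trig[OF P[OF s] Q[OF s]]) auto
    qed (use x y in auto)
    thus ?thesis by simp
  qed
  have Z: "\<bar>Z x - Z y\<bar> \<le> (4 * e * B) * \<bar>x - y\<bar>"
  proof -
    have "norm (Z x - Z y) \<le> (4 * e * B) * norm (x - y)"
    proof (rule field_differentiable_bound[where S = "{-R..R}" and f' =
      "\<lambda>s. P s * sin (s - y) + Q s * cos (s - y)"])
      fix s assume "s \<in> {-R..R}"
      hence s: "\<bar>s\<bar> \<le> R" by auto
      show "(Z has_real_derivative P s * sin (s - y) + Q s * cos (s - y)) (at s within {-R..R})"
        unfolding Z_def
        by (rule DERIV_subset[of _ _ _ UNIV]) (auto intro!: derivative_eq_intros dS[OF s] dC[OF s]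
          simp: algebra_simps)
      show "norm (P s * sin (s - y) + Q s * cos (s - y)) \<le> 4 * e * B"
        unfolding real_norm_def by (rule trig[OF P[OF s] Q[OF s]]) auto
    qed (use x y in auto)
    thus ?thesis by simp
  qed
  have "(4 * e * B) * \<bar>x - y\<bar> \<le> (4 * e * B) * (2 * R)"
    using x y e B by (intro mult_left_mono) auto
  moreover have "\<bar>Z y - M0\<bar> \<le> 4 * e * R * B"
    using energy(2)[OF _ _ _ _ y]
      by (simp add: Z_def S_def C_def B_def M0_def power2_eq_square algebra_simps)
  \<comment> \<open>The 12 is 8 from the drift of \<open>Z\<close> over a length of at most
    \<open>2 * R\<close>, plus 4 from the drift of the energy between 0 and
    \<open>y\<close>.\<close>
  ultimately have Z': "\<bar>Z x - M0\<bar> \<le> 12 * e * B * R"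
    using Z by (simp add: mult_ac)
  have W': "\<bar>W x\<bar> \<le> 4 * e * B * \<bar>x - y\<bar>"
    using W by (simp add: W_def S_def)
  have "W x * cos (x - y) + Z x * sin (x - y) = S x * ((cos (x - y))\<^sup>2 + (sin (x - y))\<^sup>2)"
    unfolding W_def Z_def by algebra
  hence "S x - M0 * sin (x - y) = W x * cos (x - y) + (Z x - M0) * sin (x - y)"
    by (simp add: algebra_simps)
  also have "\<bar>\<dots>\<bar> \<le> \<bar>W x\<bar> * \<bar>cos (x - y)\<bar> + \<bar>Z x - M0\<bar> * \<bar>sin (x - y)\<bar>"
    using abs_triangle_ineq[of "W x * cos (x - y)" "(Z x - M0) * sin (x - y)"]
      by (simp add: abs_mult)
  also have "\<dots> \<le> (4 * e * B * \<bar>x - y\<bar>) * 1 + (12 * e * B * R) * \<bar>x - y\<bar>"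
    using W' Z' abs_sin_x_le_abs_x[of "x - y"] e B R
    by (intro add_mono mult_mono) auto
  finally show ?thesis by (simp add: S_def B_def algebra_simps)
qed

section \<open>Central binomial coefficients and boundary values of binomial series\<close>

text \<open>Gauss's limit formula for \<open>Gamma z\<close>, with its Pochhammer symbol written as
  a quotient of two Gamma values.\<close>

lemma Gamma_ratio_tendsto_1:
  fixes z :: real
  assumes "z > 0"
  shows "(\<lambda>n. Gamma (real n + 1 + z) / (fact n * real n powr z)) \<longlonglongrightarrow> 1"
proof -
  have z: "z \<notin> \<int>\<^sub>\<le>\<^sub>0" using assms by (auto elim!: nonpos_Ints_cases)
  have G: "Gamma z > 0" using assms by (rule Gamma_real_pos)
  have "(\<lambda>n. Gamma z / Gamma_series z n) \<longlonglongrightarrow> Gamma z / Gamma z"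
    using G by (intro tendsto_intros) auto
  hence "(\<lambda>n. Gamma z / Gamma_series z n) \<longlonglongrightarrow> 1" using G by simp
  moreover have "eventually (\<lambda>n. Gamma z / Gamma_series z n =
    Gamma (real n + 1 + z) / (fact n * real n powr z)) sequentially"
    using eventually_gt_at_top[of 0]
  proof eventually_elim
    case (elim n)
    thus ?case using G pochhammer_Gamma[OF z, of "Suc n"]
      by (simp add: Gamma_series_def powr_def add_ac)
  qed
  ultimately show ?thesis by (rule Lim_transform_eventually)
qed

text \<open>The central binomial coefficient is
  \<open>4 ^ r * Gamma (r + 1/2) / (sqrt pi * fact r)\<close>, so the Gamma ratio with
  \<open>z = 1/2\<close> applies; the factor \<open>r / (r + 1/2)\<close> accounts for the shift of
  the argument by 1.\<close>

lemma central_binomial_tendsto: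
  "(\<lambda>r. real ((2 * r) choose r) * sqrt (real r) / 4 ^ r) \<longlonglongrightarrow> 1 / sqrt pi"
proof -
  have "(\<lambda>r. (1 / sqrt pi) * (Gamma (real r + 1 +
    1/2) / (fact r * real r powr (1/2))) * (real r / (real r + 1/2)))
     \<longlonglongrightarrow> (1 / sqrt pi) * 1 * 1"
    by (intro tendsto_intros Gamma_ratio_tendsto_1) (simp, real_asymp)
  moreover have "eventually (\<lambda>r. (1 / sqrt pi) * (Gamma (real r + 1 +
    1/2) / (fact r * real r powr (1/2))) * (real r / (real r + 1/2))
      = real ((2 * r) choose r) * sqrt (real r) / 4 ^ r) sequentially"
    using eventually_gt_at_top[of 0]
  proof eventually_elim
    case (elim r)
    have half: "(1/2::real) \<notin> \<int>\<^sub>\<le>\<^sub>0" by (auto elim!: nonpos_Ints_cases)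
    have "real r + 1/2 > 0" by simp
    hence half_r: "real r + 1/2 \<notin> \<int>\<^sub>\<le>\<^sub>0" using nonpos_Ints_nonpos[of "real r + 1/2"] by linarith
    have poch: "pochhammer (1/2::real) r = Gamma (real r + 1/2) / sqrt pi"
      using pochhammer_Gamma[OF half, of r] by (simp add: Gamma_one_half_real add_ac)
    have G: "Gamma (real r + 1 + 1/2) = (real r + 1/2) * Gamma (real r + 1/2)"
      using Gamma_plus1[OF half_r] by (simp add: add_ac)
    have "real ((2 * r) choose r) = fact (2 * r) / (fact r * fact r)"
      by (simp add: binomial_fact)
    also have "\<dots> = 4 ^ r * pochhammer (1/2) r / fact r"
      by (subst fact_double) (simp add: power_mult)
    finally have 1: "real ((2 * r) choose r) = 4 ^ r * (Gamma (real r + 1/2) / sqrt pi) / fact r"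
      unfolding poch .
    have sq: "real r = sqrt (real r) * sqrt (real r)" by simp
    have "real r + 1/2 > 0" by simp
    hence "(1 / sqrt pi) * (((real r + 1/2) * Gamma (real r +
      1/2)) / (fact r * sqrt (real r))) * (real r / (real r + 1/2))
       = Gamma (real r + 1/2) / sqrt pi / fact r * (real r / sqrt (real r))"
      by (simp add: divide_simps)
    also have "real r / sqrt (real r) = sqrt (real r)" by (simp add: real_div_sqrt)
    finally show ?case unfolding 1 G powr_half_sqrt[OF of_nat_0_le_iff] by simp
  qed
  ultimately show ?thesis by (simp add: Lim_transform_eventually)
qed

text \<open>The normalised binomial coefficient at distance \<open>l\<close> from the centre of row
  \<open>2 * r\<close>. The value 0 for \<open>l > r\<close> turns the finite sums for the values at
  the origin into series to which dominated convergence applies.\<close>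

definition central_weight :: "nat \<Rightarrow> nat \<Rightarrow> real" where
  "central_weight l r = (if l \<le>
    r then real ((2 * r) choose (r - l)) * sqrt (real r) / 4 ^ r else 0)"

text \<open>Moving one place away from the centre multiplies the weight by
  \<open>(r - l) / (r + l + 1)\<close>, which tends to 1 for fixed \<open>l\<close>; the limit is
  therefore the same for all \<open>l\<close>.\<close>

lemma central_weight_tendsto: "central_weight l \<longlonglongrightarrow> 1 / sqrt pi"
proof (induction l)
  case 0
  show ?case using central_binomial_tendsto by (simp add: central_weight_def[abs_def])
next
  case (Suc l)
  have "(\<lambda>r. central_weight l r * ((real r - real l) / (real r + real l + 1))) \<longlonglongrightarrow> 1 / sqrt pi * 1"
    by (intro tendsto_mult Suc) real_asymp
  moreover have "eventually (\<lambda>r. central_weight l r * ((real r - real l) / (real r + real l + 1)) =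
    central_weight (Suc l) r) sequentially"
    using eventually_gt_at_top[of l]
  proof eventually_elim
    case (elim r)
    define k where "k = r - Suc l"
    have k: "r - l = Suc k" "real k = real r - real l - 1" using elim by (auto simp: k_def)
    have "Suc k * ((2 * r) choose Suc k) = (2 * r - k) * ((2 * r) choose k)"
      using binomial_absorption[of k "2 * r"] binomial_absorb_comp[of "2 * r" k] elim by simp
    hence "real (Suc k) * real ((2 * r) choose Suc k) = real (2 * r - k) * real ((2 * r) choose k)"
      unfolding of_nat_mult[symmetric] of_nat_eq_iff .
    moreover have "real (2 * r - k) = real r + real l + 1" using k(2) elim
      by (simp add: k_def of_nat_diff)
    ultimately have "real ((2 * r) choose k) =
      real ((2 * r) choose Suc k) * (real r - real l) / (real r + real l + 1)"
      using k(2) by (simp add: field_simps)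
    moreover have "l \<le> r" "Suc l \<le> r" using elim by auto
    ultimately show ?case by (simp add: central_weight_def k(1) k_def[symmetric] mult_ac)
  qed
  ultimately show ?case by (simp add: Lim_transform_eventually)
qed

text \<open>The central entry is the largest of its row, and the central weights converge.
  Uniformity in both indices is what domination requires.\<close>

lemma central_weight_bounded: "\<exists>B. \<forall>l r. 0 \<le> central_weight l r \<and> central_weight l r \<le> B"
proof -
  have "Bseq (central_weight 0)"
    using central_weight_tendsto[of 0] convergent_imp_Bseq convergent_def by blast
  then obtain B where B: "\<And>r. norm (central_weight 0 r) \<le> B" by (auto simp: Bseq_def)
  have "central_weight l r \<le> B" for l r
  proof -
    have "central_weight l r \<le> central_weight 0 r"
      using binomial_maximum'[of r "r - l"]
      by (auto simp: central_weight_def intro!: divide_right_mono mult_right_mono)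
    also have "\<dots> \<le> B" using B[of r] by simp
    finally show ?thesis .
  qed
  moreover have "0 \<le> central_weight l r" for l r by (simp add: central_weight_def)
  ultimately show ?thesis by blast
qed

text \<open>The coefficients are of order \<open>n powr (- \<alpha> - 1)\<close>, which is summable
  because \<open>\<alpha> > 0\<close>.\<close>

lemma summable_abs_gbinomial:
  fixes \<alpha> :: real
  assumes "\<alpha> > 0"
  shows "summable (\<lambda>n. \<bar>\<alpha> gchoose n\<bar>)"
proof -
  have "Bseq (\<lambda>n. (\<alpha> gchoose n) / ((-1)^n / exp ((\<alpha>+1) * of_real (ln (real n)))))"
    using gbinomial_asymptotic[of \<alpha>] convergent_imp_Bseq convergent_def by blast
  then obtain K where K: "\<And>n. norm ((\<alpha> gchoose n) / ((-1)^n / exp ((\<alpha>+1) *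
    of_real (ln (real n))))) \<le> K"
    by (auto simp: Bseq_def)
  have "summable (\<lambda>n. K * real n powr (-(\<alpha> + 1)))"
    using assms by (intro summable_mult) (simp add: summable_real_powr_iff)
  moreover have "eventually (\<lambda>n. norm \<bar>\<alpha> gchoose n\<bar> \<le> K * real n powr (-(\<alpha> + 1))) sequentially"
    using eventually_gt_at_top[of 0]
  proof eventually_elim
    case (elim n)
    have "\<bar>\<alpha> gchoose n\<bar> * real n powr (\<alpha> + 1) \<le> K"
      using K[of n] elim by (simp add: abs_mult abs_divide powr_def power_abs)
    hence "\<bar>\<alpha> gchoose n\<bar> \<le> K / real n powr (\<alpha> + 1)" using elim by (simp add: field_simps)
    thus ?case unfolding powr_minus by (simp add: divide_inverse)
  qed
  ultimately show ?thesis by (rule summable_comparison_test_ev[rotated])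
qed

lemma tendsto_suminf_dominated:
  fixes f :: "nat \<Rightarrow> 'b \<Rightarrow> 'a :: {real_normed_algebra, banach}"
  assumes "\<And>k. (f k \<longlongrightarrow> g k) F" and "eventually (\<lambda>x. \<forall>k. norm (f k x) \<le> M k) F"
    and "summable M" and "F \<noteq> bot"
  shows "((\<lambda>x. \<Sum>k. f k x) \<longlongrightarrow> (\<Sum>k. g k)) F"
proof -
  have "eventually (\<lambda>(k, x). norm (f k x) \<le> M k) (at_top \<times>\<^sub>F F)"
    unfolding eventually_prod_filter using assms(2)
    by (intro exI[of _ "\<lambda>_. True"] exI[of _ "\<lambda>x. \<forall>k. norm (f k x) \<le> M k"]) auto
  from tannerys_theorem[OF assms(1) this assms(3,4)] show ?thesis by blast
qed

text \<open>The boundary point is approached radially. Inside the disc the series is the principal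
  power; the series passes to the limit by dominated convergence, the power because
  \<open>1 + z\<close> avoids the branch cut.\<close>

lemma gbinomial_series_boundary:
  fixes \<alpha> :: real and z :: complex
  assumes \<alpha>: "\<alpha> > 0" and z: "norm z = 1" "1 + z \<notin> \<real>\<^sub>\<le>\<^sub>0"
  shows "(\<lambda>n. complex_of_real (\<alpha> gchoose n) * z ^ n) sums ((1 + z) powr of_real \<alpha>)"
proof -
  define f where "f w = (\<Sum>n. complex_of_real (\<alpha> gchoose n) * w ^ n)" for w
  have eq: "f w = (1 + w) powr of_real \<alpha>" if "norm w < 1" for w
    using gen_binomial_complex[OF that, of "of_real \<alpha>"]
    by (simp add: f_def sums_iff gbinomial_prod_rev)
  have lim: "((\<lambda>t. complex_of_real t * z) \<longlongrightarrow> 1 * z) (at_left (1::real))"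
    by (intro tendsto_mult tendsto_const tendsto_of_real[OF tendsto_ident_at, THEN
      tendsto_eq_rhs]) simp
  have l1: "((\<lambda>t. f (complex_of_real t * z)) \<longlongrightarrow> f (1 * z)) (at_left 1)"
    unfolding f_def
  proof (rule tendsto_suminf_dominated[OF _ _ summable_abs_gbinomial[OF \<alpha>]])
    show "eventually (\<lambda>t. \<forall>k. norm (complex_of_real (\<alpha> gchoose k) * (complex_of_real t * z) ^ k) \<le>
      \<bar>\<alpha> gchoose k\<bar>) (at_left 1)"
      using eventually_at_left_real[OF zero_less_one]
      by eventually_elim (auto simp: norm_mult norm_power z mult_left_le power_le_one)
    show "((\<lambda>t. complex_of_real (\<alpha> gchoose k) * (complex_of_real t * z) ^ k) \<longlongrightarrow>
        complex_of_real (\<alpha> gchoose k) * (1 * z) ^ k) (at_left 1)" for k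
      by (intro tendsto_mult tendsto_const tendsto_power lim)
  qed simp
  have l2: "((\<lambda>t. (1 + complex_of_real t * z) powr of_real \<alpha>) \<longlongrightarrow> (1 +
    1 * z) powr of_real \<alpha>) (at_left 1)"
    by (intro tendsto_powr_complex tendsto_add tendsto_const lim) (use z in simp)
  have ev: "eventually (\<lambda>t. f (complex_of_real t * z) =
    (1 + complex_of_real t * z) powr of_real \<alpha>) (at_left (1::real))"
    using eventually_at_left_real[OF zero_less_one] by eventually_elim (auto simp: eq norm_mult z)
  have "f (1 * z) = (1 + 1 * z) powr of_real \<alpha>"
    by (rule tendsto_unique[OF trivial_limit_at_left_real Lim_transform_eventually[OF l1 ev] l2])
  moreover have "summable (\<lambda>n. complex_of_real (\<alpha> gchoose n) * z ^ n)"
    using summable_abs_gbinomial[OF \<alpha>] z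
      by (intro summable_norm_cancel[where f =
      "\<lambda>n. complex_of_real (\<alpha> gchoose n) * z ^ n"]) (simp add: norm_mult norm_power)
  ultimately show ?thesis by (simp add: f_def sums_iff)
qed

section \<open>Jacobi polynomials at the origin\<close>

text \<open>The binomial series of \<open>(1 - X) ^ \<beta>\<close> for real \<open>\<beta>\<close>,
  the counterpart of \<open>fps_binomial\<close>.\<close>

definition fps_binomial_neg :: "real \<Rightarrow> real fps" where
  "fps_binomial_neg \<beta> = Abs_fps (\<lambda>n. (-1) ^ n * (\<beta> gchoose n))"

lemma fps_binomial_neg_add_nat: "fps_binomial_neg (\<beta> + real n) =
  fps_binomial_neg \<beta> * (1 - fps_X) ^ n"
proof (induction n)
  case (Suc n)
  have step: "fps_binomial_neg (t + 1) = fps_binomial_neg t * (1 - fps_X)" for t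
  proof (rule fps_ext)
    fix k
    show "fps_nth (fps_binomial_neg (t + 1)) k = fps_nth (fps_binomial_neg t * (1 - fps_X)) k"
      by (cases k) (simp_all add: fps_binomial_neg_def ring_distribs gbinomial_Suc_Suc)
  qed
  have "fps_binomial_neg (\<beta> + real (Suc n)) = fps_binomial_neg ((\<beta> + real n) + 1)"
    by (simp add: add_ac)
  also have "\<dots> = fps_binomial_neg \<beta> * (1 - fps_X) ^ n * (1 - fps_X)"
    unfolding step Suc.IH ..
  finally show ?case by (simp add: mult_ac)
qed simp

definition jacobi_fps :: "real \<Rightarrow> real \<Rightarrow> real fps" where
  "jacobi_fps a b = fps_binomial (a + 1) * fps_binomial_neg (b + 1)"

text \<open>At the origin \<open>u = -1/2\<close> and \<open>v = 1/2\<close>, so the defining sum in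
  degree \<open>m\<close> is the coefficient of \<open>z^m\<close> in
  \<open>(1 + z)^(m + a) * (1 - z)^(m + b)\<close>. With \<open>m = Suc n\<close>, taking out
  \<open>(1 - z^2)^n\<close> leaves the exponents \<open>a + 1\<close> and
  \<open>b + 1\<close>.\<close>

lemma jacobiP_0_eq_nth:
  "2 ^ Suc n * jacobiP (Suc n) a b 0 = fps_nth (jacobi_fps a b * (1 - fps_X\<^sup>2) ^ n) (Suc n)"
proof -
  have "jacobi_fps a b * (1 - fps_X\<^sup>2) ^ n =
      (fps_binomial (a + 1) * fps_binomial (real n)) * (fps_binomial_neg (b + 1) * (1 - fps_X) ^ n)"
  proof -
    have "(1 - fps_X\<^sup>2 :: real fps) = (1 + fps_X) * (1 - fps_X)"
      by (simp add: algebra_simps power2_eq_square)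
    thus ?thesis unfolding jacobi_fps_def fps_binomial_of_nat
      by (simp only: power_mult_distrib mult_ac)
  qed
  also have "\<dots> = fps_binomial (real (Suc n) + a) * fps_binomial_neg (real (Suc n) + b)"
    unfolding fps_binomial_add_mult[symmetric] fps_binomial_neg_add_nat[symmetric]
      by (simp add: add_ac)
  finally have *: "jacobi_fps a b * (1 - fps_X\<^sup>2) ^ n =
    fps_binomial (real (Suc n) + a) * fps_binomial_neg (real (Suc n) + b)" .
  have "2 ^ Suc n * jacobiP (Suc n) a b 0 =
    (\<Sum>s\<le>Suc n. ((real (Suc n) + a) gchoose (Suc n - s)) * ((real (Suc n) + b) gchoose s)
              * (2 ^ Suc n * ((- 1 / 2) ^ s * (1 / 2) ^ (Suc n - s))))"
    unfolding jacobiP_def sum_distrib_left by (intro sum.cong refl) simp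
  also have "\<dots> = (\<Sum>s\<le>Suc n. ((real (Suc n) + a) gchoose (Suc n - s)) * ((-1) ^ s * ((real (Suc n) +
    b) gchoose s)))"
  proof (intro sum.cong refl)
    fix s assume s: "s \<in> {..Suc n}"
    have "(2::real) ^ Suc n = 2 ^ s * 2 ^ (Suc n - s)" using s
      by (simp add: power_add[symmetric] del: power_Suc)
    hence "2 ^ Suc n * ((- 1 / 2) ^ s * (1 / 2) ^ (Suc n - s)) =
      (2 * (-1/2)) ^ s * (2 * (1 / 2 :: real)) ^ (Suc n - s)"
      unfolding power_mult_distrib by (simp only: mult_ac)
    thus "((real (Suc n) + a) gchoose (Suc n - s)) * ((real (Suc n) +
      b) gchoose s) * (2 ^ Suc n * ((- 1 / 2) ^ s * (1 / 2) ^ (Suc n - s)))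
       = ((real (Suc n) + a) gchoose (Suc n - s)) * ((-1) ^ s * ((real (Suc n) + b) gchoose s))"
      by simp
  qed
  also have "\<dots> = fps_nth (fps_binomial_neg (real (Suc n) + b) * fps_binomial (real (Suc n) +
    a)) (Suc n)"
    unfolding fps_mult_nth atMost_atLeast0 fps_binomial_neg_def fps_nth_Abs_fps fps_binomial_nth
    by (simp only: mult_ac)
  finally show ?thesis unfolding * by (simp only: mult_ac)
qed

lemma fps_mult_one_minus_X2_power_nth:
  fixes g :: "real fps"
  shows "fps_nth (g * (1 - fps_X\<^sup>2) ^ n) m =
    (\<Sum>j\<le>n. real (n choose j) * (-1) ^ j * (if m < 2 * j then 0 else fps_nth g (m - 2 * j)))"
proof -
  have "g * (1 - fps_X\<^sup>2) ^ n = g * ((- fps_X\<^sup>2) + 1) ^ n" by simp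
  also have "\<dots> = (\<Sum>j\<le>n. fps_const (real (n choose j) * (-1) ^ j) * (g * fps_X ^ (2 * j)))"
    unfolding binomial_ring sum_distrib_left
  proof (intro sum.cong refl)
    fix j
    have "(- fps_X\<^sup>2) ^ j = fps_const ((-1) ^ j) * (fps_X ^ (2 * j) :: real fps)"
      by (subst power_minus) (simp add: power_mult fps_const_power[symmetric] del: fps_const_power)
    thus "g * (of_nat (n choose j) * (- fps_X\<^sup>2) ^ j * 1 ^ (n - j)) =
       fps_const (real (n choose j) * (-1) ^ j) * (g * fps_X ^ (2 * j))"
      by (simp add: fps_const_mult[symmetric] fps_of_nat mult_ac del: fps_const_mult)
  qed
  finally show ?thesis by (simp add: fps_sum_nth fps_X_power_mult_right_nth)
qed

text \<open>Only coefficients of odd index can contribute to an odd degree. The substitution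
  \<open>j = r - l\<close> measures the binomial coefficients from the centre of the row, where they
  are all comparable.\<close>

lemma jacobiP_0_odd:
  "2 ^ Suc (2 * r) * jacobiP (Suc (2 * r)) a b 0 =
     (\<Sum>l\<le>r. real ((2 * r) choose (r - l)) * (-1) ^ (r -
       l) * fps_nth (jacobi_fps a b) (Suc (2 * l)))"
proof -
  let ?f = "\<lambda>j. real ((2 * r) choose j) * (-1) ^ j * (if Suc (2 * r) < 2 *
    j then 0 else fps_nth (jacobi_fps a b) (Suc (2 * r) - 2 * j))"
  have "2 ^ Suc (2 * r) * jacobiP (Suc (2 * r)) a b 0 = (\<Sum>j\<le>2 * r. ?f j)"
    unfolding jacobiP_0_eq_nth fps_mult_one_minus_X2_power_nth ..
  also have "\<dots> = (\<Sum>j\<le>r. ?f j)"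
    by (intro sum.mono_neutral_right) auto
  also have "\<dots> = (\<Sum>l\<le>r. ?f (r - l))"
    by (rule sum.reindex_bij_witness[of _ "\<lambda>j. r - j" "\<lambda>j. r - j"]) auto
  also have "\<dots> = (\<Sum>l\<le>r. real ((2 * r) choose (r - l)) * (-1) ^ (r -
    l) * fps_nth (jacobi_fps a b) (Suc (2 * l)))"
  proof (intro sum.cong refl)
    fix l assume "l \<in> {..r}"
    hence "\<not> Suc (2 * r) < 2 * (r - l)" "Suc (2 * r) - 2 * (r - l) = Suc (2 * l)" by auto
    thus "?f (r - l) = real ((2 * r) choose (r - l)) * (-1) ^ (r -
      l) * fps_nth (jacobi_fps a b) (Suc (2 * l))" by (simp only: if_False)
  qed
  finally show ?thesis .
qed

text \<open>Here the row \<open>2 * r - 1\<close> is odd and has no single centre;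
  \<open>r \<ge> 1\<close> guarantees that \<open>2 * r - 1\<close> is not truncated.\<close>

lemma jacobiP_0_even:
  assumes "r \<ge> 1"
  shows "2 ^ (2 * r) * jacobiP (2 * r) a b 0 =
     (\<Sum>l\<le>r. real ((2 * r - 1) choose (r - l)) * (-1) ^ (r - l) * fps_nth (jacobi_fps a b) (2 * l))"
proof -
  let ?f = "\<lambda>j. real ((2 * r -
    1) choose j) * (-1) ^ j * (if 2 * r < 2 * j then 0 else fps_nth (jacobi_fps a b) (2 * r -
    2 * j))"
  have r: "Suc (2 * r - 1) = 2 * r" using assms by simp
  have "2 ^ (2 * r) * jacobiP (2 * r) a b 0 = (\<Sum>j\<le>2 * r - 1. ?f j)"
    using jacobiP_0_eq_nth[of "2 * r - 1" a b] unfolding fps_mult_one_minus_X2_power_nth r .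
  also have "\<dots> = (\<Sum>j\<le>r. ?f j)"
    using assms by (intro sum.mono_neutral_right) auto
  also have "\<dots> = (\<Sum>l\<le>r. ?f (r - l))"
    by (rule sum.reindex_bij_witness[of _ "\<lambda>j. r - j" "\<lambda>j. r - j"]) auto
  also have "\<dots> = (\<Sum>l\<le>r. real ((2 * r - 1) choose (r - l)) * (-1) ^ (r -
    l) * fps_nth (jacobi_fps a b) (2 * l))"
  proof (intro sum.cong refl)
    fix l assume "l \<in> {..r}"
    hence "\<not> 2 * r < 2 * (r - l)" "2 * r - 2 * (r - l) = 2 * l" by auto
    thus "?f (r - l) = real ((2 * r - 1) choose (r - l)) * (-1) ^ (r -
      l) * fps_nth (jacobi_fps a b) (2 * l)" by (simp only: if_False)
  qed
  finally show ?thesis .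
qed

context
  fixes a b :: real
  assumes ab: "a > -1" "b > -1"
begin

text \<open>The two binomial series converge absolutely at \<open>\<i>\<close> and
  \<open>- \<i>\<close>, so their Cauchy product may be formed. The first claim provides the
  majorant for dominated convergence, the second identifies the limit.\<close>

lemma jacobi_fps_at_i:
  shows "summable (\<lambda>k. \<bar>fps_nth (jacobi_fps a b) k\<bar>)"
    and "(\<lambda>k. complex_of_real (fps_nth (jacobi_fps a b) k) * \<i> ^ k) sums
           ((1 + \<i>) powr of_real (a + 1) * (1 - \<i>) powr of_real (b + 1))"
proof -
  define A where "A n = complex_of_real ((a + 1) gchoose n) * \<i> ^ n" for n
  define B where "B n = complex_of_real ((b + 1) gchoose n) * (- \<i>) ^ n" for n
  have sA: "summable (\<lambda>n. norm (A n))" and sB: "summable (\<lambda>n. norm (B n))"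
    using summable_abs_gbinomial[of "a + 1"] summable_abs_gbinomial[of "b + 1"] ab
    by (simp_all add: A_def B_def norm_mult norm_power)
  have coeff: "(\<Sum>i\<le>k. A i * B (k - i)) = complex_of_real (fps_nth (jacobi_fps a b) k) * \<i> ^ k" for k
  proof -
    have "A i * B (k - i) = complex_of_real (((a + 1) gchoose i) * ((-1) ^ (k - i) * ((b +
      1) gchoose (k - i)))) * \<i> ^ k"
      if "i \<le> k" for i
    proof -
      have "(- \<i>) ^ (k - i) = (-1) ^ (k - i) * \<i> ^ (k - i)" by (subst power_minus) simp
      moreover have "\<i> ^ k = \<i> ^ i * \<i> ^ (k - i)" using that by (simp add: power_add[symmetric])
      ultimately show ?thesis by (simp add: A_def B_def mult_ac)
    qed
    thus ?thesis
      by (simp add: jacobi_fps_def fps_mult_nth fps_binomial_neg_def atMost_atLeast0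
        sum_distrib_right)
  qed
  have nI: "1 + \<i> \<notin> \<real>\<^sub>\<le>\<^sub>0" "1 + - \<i> \<notin> \<real>\<^sub>\<le>\<^sub>0" by (auto simp: complex_nonpos_Reals_iff)
  have "(\<Sum>n. A n) = (1 + \<i>) powr of_real (a + 1)"
    using gbinomial_series_boundary[of "a + 1" \<i>] ab nI unfolding A_def sums_iff by simp
  moreover have "(\<Sum>n. B n) = (1 - \<i>) powr of_real (b + 1)"
    using gbinomial_series_boundary[of "b + 1" "- \<i>"] ab nI unfolding B_def sums_iff by simp
  ultimately show "(\<lambda>k. complex_of_real (fps_nth (jacobi_fps a b) k) * \<i> ^ k) sums
           ((1 + \<i>) powr of_real (a + 1) * (1 - \<i>) powr of_real (b + 1))"
    using Cauchy_product_sums[OF sA sB] unfolding coeff by simp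
  show "summable (\<lambda>k. \<bar>fps_nth (jacobi_fps a b) k\<bar>)"
  proof (rule summable_comparison_test)
    show "summable (\<lambda>k. \<Sum>i\<le>k. norm (A i) * norm (B (k - i)))"
      by (rule summable_Cauchy_product) (use sA sB in simp_all)
    show "\<exists>N. \<forall>k\<ge>N. norm \<bar>fps_nth (jacobi_fps a b) k\<bar> \<le> (\<Sum>i\<le>k. norm (A i) * norm (B (k - i)))"
    proof (intro exI allI impI)
      fix k
      have "norm \<bar>fps_nth (jacobi_fps a b) k\<bar> = norm (\<Sum>i\<le>k. A i * B (k - i))"
        unfolding coeff by (simp add: norm_mult norm_power)
      also have "\<dots> \<le> (\<Sum>i\<le>k. norm (A i * B (k - i)))" by (rule norm_sum)
      finally show "norm \<bar>fps_nth (jacobi_fps a b) k\<bar> \<le> (\<Sum>i\<le>k. norm (A i) * norm (B (k - i)))"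
        by (simp add: norm_mult)
    qed
  qed
qed

end

text \<open>Tannery's theorem with one weight for both members of a pair of indices.
  \<open>T\<close> will be the imaginary or the real part of the coefficients times
  \<open>\<i> ^ k\<close>, so one member of each pair vanishes and both parities of the degree are
  covered.\<close>

lemma paired_sum_tendsto:
  fixes T :: "nat \<Rightarrow> real" and w :: "nat \<Rightarrow> nat \<Rightarrow> real"
  assumes lim: "\<And>l. w l \<longlonglongrightarrow> c" and bound: "\<And>l r. \<bar>w l r\<bar> \<le> B"
    and zero: "\<And>l r. l > r \<Longrightarrow> w l r = 0" and T: "summable (\<lambda>k. \<bar>T k\<bar>)"
  shows "(\<lambda>r. \<Sum>l\<le>r. w l r * (T (2 * l) + T (Suc (2 * l)))) \<longlonglongrightarrow> c * (\<Sum>k. T k)"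
proof -
  have "(\<lambda>r. \<Sum>k. w (k div 2) r * T k) \<longlonglongrightarrow> (\<Sum>k. c * T k)"
  proof (rule tendsto_suminf_dominated[where M = "\<lambda>k. B * \<bar>T k\<bar>"])
    show "(\<lambda>r. w (k div 2) r * T k) \<longlonglongrightarrow> c * T k" for k
      by (intro tendsto_mult lim tendsto_const)
    show "eventually (\<lambda>r. \<forall>k. norm (w (k div 2) r * T k) \<le> B * \<bar>T k\<bar>) sequentially"
      using bound by (intro always_eventually allI) (auto simp: abs_mult intro!: mult_right_mono)
    show "summable (\<lambda>k. B * \<bar>T k\<bar>)" by (intro summable_mult T)
  qed simp
  also have "(\<Sum>k. c * T k) = c * (\<Sum>k. T k)"
    using summable_rabs_cancel[OF T] by (rule suminf_mult)
  also have "(\<lambda>r. \<Sum>k. w (k div 2) r * T k) = (\<lambda>r. \<Sum>l\<le>r. w l r * (T (2 * l) + T (Suc (2 * l))))"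
  proof
    fix r
    have "(\<Sum>k. w (k div 2) r * T k) = (\<Sum>k\<le>Suc (2 * r). w (k div 2) r * T k)"
      by (rule suminf_finite) (auto intro!: zero)
    also have "\<dots> = (\<Sum>l\<le>r. w l r * (T (2 * l) + T (Suc (2 * l))))"
      unfolding sum.in_pairs_0 by (simp add: distrib_left)
    finally show "(\<Sum>k. w (k div 2) r * T k) = (\<Sum>l\<le>r. w l r * (T (2 * l) + T (Suc (2 * l))))" .
  qed
  finally show ?thesis .
qed

lemma ii_power_double: "\<i> ^ (2 * l) = complex_of_real ((-1) ^ l)"
  by (simp add: power_mult)

text \<open>The value \<open>g(\<i>)\<close> of the generating function of the overview.\<close>

definition jacobi_amplitude :: "real \<Rightarrow> real \<Rightarrow> complex" where
  "jacobi_amplitude a b = (1 + \<i>) powr of_real (a + 1) * (1 - \<i>) powr of_real (b + 1)"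

lemma norm_jacobi_amplitude: "(norm (jacobi_amplitude a b))\<^sup>2 = 4 * 2 powr (a + b)"
proof -
  have n: "norm (1 + \<i>) = 2 powr (1 / 2)" "norm (1 - \<i>) = 2 powr (1 / 2)"
    by (simp_all add: cmod_def powr_half_sqrt)
  have "norm ((1 + \<i>) powr of_real (a + 1)) = norm (1 + \<i>) powr (a + 1)"
    "norm ((1 - \<i>) powr of_real (b + 1)) = norm (1 - \<i>) powr (b + 1)"
    by (simp_all add: norm_powr_real_powr')
  hence "norm (jacobi_amplitude a b) = 2 powr ((a + 1) / 2) * 2 powr ((b + 1) / 2)"
    unfolding jacobi_amplitude_def norm_mult n by (simp add: powr_powr)
  also have "\<dots> = 2 powr ((a + b) / 2 + 1)"
    by (simp add: powr_add[symmetric] add_divide_distrib add_ac)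
  finally have "(norm (jacobi_amplitude a b))\<^sup>2 = 2 powr (2 + (a + b))"
    by (simp add: power2_eq_square powr_add[symmetric] algebra_simps)
  thus ?thesis by (simp add: powr_add)
qed

section \<open>Limits of the values and norms\<close>

context
  fixes a b :: real
  assumes ab: "a > -1" "b > -1"
begin

lemma summable_jacobi_fps_i:
  shows "summable (\<lambda>k. \<bar>Re (complex_of_real (fps_nth (jacobi_fps a b) k) * \<i> ^ k)\<bar>)"
    and "summable (\<lambda>k. \<bar>Im (complex_of_real (fps_nth (jacobi_fps a b) k) * \<i> ^ k)\<bar>)"
proof -
  have n: "norm (complex_of_real (fps_nth (jacobi_fps a b) k) * \<i> ^ k) =
    \<bar>fps_nth (jacobi_fps a b) k\<bar>" for k
    by (simp add: norm_mult norm_power)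
  show "summable (\<lambda>k. \<bar>Re (complex_of_real (fps_nth (jacobi_fps a b) k) * \<i> ^ k)\<bar>)"
    by (rule summable_comparison_test[OF _ jacobi_fps_at_i(1)[OF ab]])
       (metis n abs_Re_le_cmod abs_idempotent real_norm_def)
  show "summable (\<lambda>k. \<bar>Im (complex_of_real (fps_nth (jacobi_fps a b) k) * \<i> ^ k)\<bar>)"
    by (rule summable_comparison_test[OF _ jacobi_fps_at_i(1)[OF ab]])
       (metis n abs_Im_le_cmod abs_idempotent real_norm_def)
qed

lemma jacobiP_0_odd_tendsto:
  "(\<lambda>r. (-1) ^ r * jacobiP (Suc (2 * r)) a b 0 * sqrt (real r)) \<longlonglongrightarrow>
    Im (jacobi_amplitude a b) / (2 * sqrt pi)"
proof -
  define T where "T k = Im (complex_of_real (fps_nth (jacobi_fps a b) k) * \<i> ^ k)" for k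
  have T: "T (2 * l) = 0" "T (Suc (2 * l)) =
    (-1) ^ l * fps_nth (jacobi_fps a b) (Suc (2 * l))" for l
    unfolding T_def power_Suc ii_power_double by simp_all
  obtain B where B: "\<And>l r. 0 \<le> central_weight l r \<and> central_weight l r \<le> B"
    using central_weight_bounded by blast
  have "(\<lambda>r. \<Sum>l\<le>r. central_weight l r * (T (2 * l) + T (Suc (2 * l)))) \<longlonglongrightarrow> 1 / sqrt pi * (\<Sum>k. T k)"
  proof (rule paired_sum_tendsto[OF central_weight_tendsto])
    show "\<bar>central_weight l r\<bar> \<le> B" for l r using B[of l r] by simp
    show "summable (\<lambda>k. \<bar>T k\<bar>)" unfolding T_def by (rule summable_jacobi_fps_i)
  qed (simp add: central_weight_def)
  moreover have "(\<Sum>k. T k) = Im (jacobi_amplitude a b)"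
    using sums_Im[OF jacobi_fps_at_i(2)[OF ab]]
      unfolding T_def jacobi_amplitude_def sums_iff by simp
  ultimately have "(\<lambda>r. 1 / 2 * (\<Sum>l\<le>r. central_weight l r * (T (2 * l) + T (Suc (2 * l))))) \<longlonglongrightarrow>
    1 / 2 * (1 / sqrt pi * Im (jacobi_amplitude a b))"
    by (intro tendsto_mult tendsto_const) simp
  moreover have "1 / 2 * (\<Sum>l\<le>r. central_weight l r * (T (2 * l) + T (Suc (2 * l)))) =
     (-1) ^ r * jacobiP (Suc (2 * r)) a b 0 * sqrt (real r)" for r
  proof -
    have "(-1) ^ r * jacobiP (Suc (2 * r)) a b 0 * sqrt (real r) =
       (2 ^ Suc (2 * r) * jacobiP (Suc (2 * r)) a b 0) * ((-1) ^ r * sqrt (real r) / (2 * 4 ^ r))"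
      by (simp add: power_mult)
    also have "\<dots> = (\<Sum>l\<le>r. 1 / 2 * (central_weight l r * (T (2 * l) + T (Suc (2 * l)))))"
      unfolding jacobiP_0_odd sum_distrib_right
    proof (intro sum.cong refl)
      fix l assume l: "l \<in> {..r}"
      \<comment> \<open>The sign from the expansion and the normalising sign \<open>(-1) ^ r\<close>
        combine to \<open>(-1) ^ l\<close>, the value of \<open>\<i> ^ (2 * l)\<close>.\<close>
      have sgn: "(-1) ^ (r - l) * (-1) ^ r = (-1 :: real) ^ l"
        using l by (auto simp: minus_one_power_iff)
      show "real (2 * r choose (r - l)) * (- 1) ^ (r - l) * fps_nth (jacobi_fps a b) (Suc (2 * l)) *
         ((- 1) ^ r * sqrt (real r) / (2 * 4 ^ r)) =
         1 / 2 * (central_weight l r * (T (2 * l) + T (Suc (2 * l))))"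
        using l unfolding T sgn[symmetric] by (simp add: central_weight_def)
    qed
    finally show ?thesis by (simp only: sum_distrib_left)
  qed
  ultimately show ?thesis by simp
qed

lemma jacobiP_0_even_tendsto:
  "(\<lambda>r. (-1) ^ r * jacobiP (2 * r) a b 0 * sqrt (real r)) \<longlonglongrightarrow>
    Re (jacobi_amplitude a b) / (2 * sqrt pi)"
proof -
  define T where "T k = Re (complex_of_real (fps_nth (jacobi_fps a b) k) * \<i> ^ k)" for k
  have T: "T (Suc (2 * l)) = 0" "T (2 * l) = (-1) ^ l * fps_nth (jacobi_fps a b) (2 * l)" for l
    unfolding T_def power_Suc ii_power_double by simp_all
  obtain B where B: "\<And>l r. 0 \<le> central_weight l r \<and> central_weight l r \<le> B"
    using central_weight_bounded by blast
  \<comment> \<open>The factor converts row \<open>2 * r\<close> into row \<open>2 * r - 1\<close>.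
    Its limit \<open>1/2\<close> matches the \<open>1/2\<close> which arises in odd degree from
    \<open>2 ^ Suc (2 * r)\<close>.\<close>
  define w where "w l r = central_weight l r * ((real r + real l) / (2 * real r))" for l r
  have "(\<lambda>r. \<Sum>l\<le>r. w l r * (T (2 * l) + T (Suc (2 * l)))) \<longlonglongrightarrow> (1 / sqrt pi * (1 / 2)) * (\<Sum>k. T k)"
  proof (rule paired_sum_tendsto)
    show "w l \<longlonglongrightarrow> 1 / sqrt pi * (1 / 2)" for l
      unfolding w_def by (intro tendsto_mult central_weight_tendsto) real_asymp
    show "\<bar>w l r\<bar> \<le> B" for l r
    proof (cases "l \<le> r")
      case True
      have "\<bar>w l r\<bar> \<le> central_weight l r * 1"
        unfolding w_def abs_mult using B[of l r] True by (intro mult_mono) (auto simp: divide_simps)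
      thus ?thesis using B[of l r] by simp
    next
      case False
      thus ?thesis using B[of l r] by (simp add: w_def central_weight_def)
    qed
    show "summable (\<lambda>k. \<bar>T k\<bar>)" unfolding T_def by (rule summable_jacobi_fps_i)
  qed (simp add: w_def central_weight_def)
  moreover have "(\<Sum>k. T k) = Re (jacobi_amplitude a b)"
    using sums_Re[OF jacobi_fps_at_i(2)[OF ab]]
      unfolding T_def jacobi_amplitude_def sums_iff by simp
  ultimately have "(\<lambda>r. \<Sum>l\<le>r. w l r * (T (2 * l) + T (Suc (2 * l)))) \<longlonglongrightarrow>
    Re (jacobi_amplitude a b) / (2 * sqrt pi)"
    by (simp add: mult.commute)
  moreover have "eventually (\<lambda>r. (\<Sum>l\<le>r. w l r * (T (2 * l) + T (Suc (2 * l)))) =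
     (-1) ^ r * jacobiP (2 * r) a b 0 * sqrt (real r)) sequentially"
    using eventually_ge_at_top[of 1]
  proof eventually_elim
    case (elim r)
    have "(-1) ^ r * jacobiP (2 * r) a b 0 * sqrt (real r) =
       (2 ^ (2 * r) * jacobiP (2 * r) a b 0) * ((-1) ^ r * sqrt (real r) / 4 ^ r)"
      by (simp add: power_mult)
    also have "\<dots> = (\<Sum>l\<le>r. w l r * (T (2 * l) + T (Suc (2 * l))))"
      unfolding jacobiP_0_even[OF elim] sum_distrib_right
    proof (intro sum.cong refl)
      fix l assume l: "l \<in> {..r}"
      have sgn: "(-1) ^ (r - l) * (-1) ^ r = (-1 :: real) ^ l"
        using l by (auto simp: minus_one_power_iff)
      have "(2 * r - (r - l)) * (2 * r choose (r - l)) = 2 * r * (2 * r - 1 choose (r - l))"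
        by (rule binomial_absorb_comp)
      moreover have "2 * r - (r - l) = r + l" using l by simp
      ultimately have "real (r + l) * real (2 * r choose (r - l)) =
        real (2 * r) * real (2 * r - 1 choose (r - l))"
        unfolding of_nat_mult[symmetric] of_nat_eq_iff by simp
      hence "real (2 * r - 1 choose (r - l)) =
        real (2 * r choose (r - l)) * ((real r + real l) / (2 * real r))"
        using elim by (simp add: field_simps)
      thus "real (2 * r - 1 choose (r - l)) * (- 1) ^ (r - l) * fps_nth (jacobi_fps a b) (2 * l) *
         ((- 1) ^ r * sqrt (real r) / 4 ^ r) = w l r * (T (2 * l) + T (Suc (2 * l)))"
        using l unfolding T sgn[symmetric] by (simp add: central_weight_def w_def mult_ac)
    qed
    finally show ?case ..
  qed
  ultimately show ?thesis by (rule Lim_transform_eventually)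
qed

text \<open>Each Gamma value is compared with a factorial times a power of \<open>n\<close>, and
  these powers cancel. The arguments are shifted so that the ratio lemma is applied at the positive
  numbers \<open>a + 1\<close>, \<open>b + 1\<close> and \<open>a + b + 2\<close>; \<open>q\<close>
  collects the linear factors caused by the shifts.\<close>

lemma jacobi_h_tendsto: "(\<lambda>n. real n * jacobi_h n a b) \<longlonglongrightarrow> 2 powr (a + b)"
proof -
  define g where "g z n = Gamma (real n + 1 + z) / (fact n * real n powr z)" for z n
  define q where "q n = real n * (real n + a + b + 2) * (real n + a + b + 1) / ((real n + a +
    1) * (real n + b + 1) * (2 * real n + a + b + 1))" for n
  have g: "g z \<longlonglongrightarrow> 1" if "z > 0" for z
    unfolding g_def by (rule Gamma_ratio_tendsto_1[OF that])
  have q: "q \<longlonglongrightarrow> 1 / 2" unfolding q_def by real_asymp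
  have "(\<lambda>n. 2 powr (a + b + 1) * (g (a + 1) n * g (b + 1) n / g (a + b + 2) n) * q n) \<longlonglongrightarrow>
    2 powr (a + b + 1) * (1 * 1 / 1) * (1 / 2)"
    using ab by (intro tendsto_mult tendsto_divide tendsto_const g q) auto
  moreover have "2 powr (a + b + 1) * (1 * 1 / 1) * (1 / 2) = 2 powr (a + b)"
    by (simp add: powr_add)
  moreover have "eventually (\<lambda>n. 2 powr (a + b + 1) * (g (a + 1) n * g (b + 1) n / g (a + b +
    2) n) * q n = real n * jacobi_h n a b) sequentially"
    using eventually_ge_at_top[of 1]
  proof eventually_elim
    case (elim n)
    have n: "real n \<ge> 1" using elim by simp
    define A B C where "A = real n + a + 1" and "B = real n + b + 1" and "C = real n + a + b + 1"
    have pos: "A > 0" "B > 0" "C > 0" using ab n unfolding A_def B_def C_def by linarith+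
    have A: "Gamma (real n + 1 + (a + 1)) = A * Gamma A" using Gamma_real_plus1[OF pos(1)]
      by (simp add: A_def add_ac)
    have B: "Gamma (real n + 1 + (b + 1)) = B * Gamma B" using Gamma_real_plus1[OF pos(2)]
      by (simp add: B_def add_ac)
    have C: "Gamma (real n + 1 + (a + b + 2)) = (C + 1) * (C * Gamma C)"
      using Gamma_real_plus1[of "C + 1"] Gamma_real_plus1[OF pos(3)] pos by (simp add: C_def add_ac)
    have pw: "real n powr (a + b + 2) = real n powr (a + 1) * real n powr (b + 1)"
      by (simp add: powr_add[symmetric] add_ac)
    have nz: "Gamma A > 0" "Gamma B > 0" "Gamma C > 0" "real n powr (a +
      1) > 0" "real n powr (b + 1) > 0"
      using pos n by (auto intro: Gamma_real_pos)
    have c: "2 * real n + a + b + 1 > 0" using n ab by linarith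
    have q': "q n = real n * (C + 1) * C / (A * B * (2 * real n + a + b + 1))"
      by (simp add: q_def A_def B_def C_def)
    have h: "jacobi_h n a b = 2 powr (a + b + 1) * Gamma A * Gamma B / (fact n * (2 * real n + a +
      b + 1) * Gamma C)"
      using elim by (simp add: jacobi_h_def A_def B_def C_def)
    show ?case unfolding g_def A B C pw q' h using nz pos n c by (simp add: divide_simps)
  qed
  ultimately show ?thesis using Lim_transform_eventually by fastforce
qed

text \<open>The squares of the imaginary and the real part add up to the squared modulus of the
  amplitude, and its factor \<open>2 powr (a + b)\<close> cancels against the limit of the norms;
  hence the limit is free of \<open>a\<close> and \<open>b\<close>.\<close>

lemma jacobi_energy_0_tendsto:
  "(\<lambda>r. (jacobiP (Suc (2 * r)) a b 0)\<^sup>2 / jacobi_h (Suc (2 * r)) a b +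
    (jacobiP (2 * r) a b 0)\<^sup>2 / jacobi_h (2 * r) a b)
     \<longlonglongrightarrow> 2 / pi"
proof -
  let ?o = "\<lambda>r. (-1) ^ r * jacobiP (Suc (2 * r)) a b 0 * sqrt (real r)"
  let ?e = "\<lambda>r. (-1) ^ r * jacobiP (2 * r) a b 0 * sqrt (real r)"
  let ?H = "\<lambda>n. real n * jacobi_h n a b"
  let ?L = "2 powr (a + b)"
  have sub: "filterlim (\<lambda>r. Suc (2 * r)) sequentially sequentially" "filterlim (\<lambda>r. 2 *
    r) sequentially sequentially"
    by (auto intro!: filterlim_subseq simp: strict_mono_def)
  have "(\<lambda>r. (?o r)\<^sup>2 / ?H (Suc (2 * r)) * (real (Suc (2 * r)) / real r) +
    (?e r)\<^sup>2 / ?H (2 * r) * (real (2 * r) / real r)) \<longlonglongrightarrow>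
      (Im (jacobi_amplitude a b) / (2 * sqrt pi))\<^sup>2 / ?L * 2 +
        (Re (jacobi_amplitude a b) / (2 * sqrt pi))\<^sup>2 / ?L * 2"
    by (intro tendsto_intros jacobiP_0_odd_tendsto jacobiP_0_even_tendsto
          filterlim_compose[OF jacobi_h_tendsto sub(1)] filterlim_compose[OF jacobi_h_tendsto
            sub(2)])
       (simp, real_asymp, simp, real_asymp)
  also have "(Im (jacobi_amplitude a b) / (2 * sqrt pi))\<^sup>2 / ?L * 2 +
    (Re (jacobi_amplitude a b) / (2 * sqrt pi))\<^sup>2 / ?L * 2
      = (norm (jacobi_amplitude a b))\<^sup>2 / (2 * pi * ?L)"
    unfolding cmod_power2 by (simp add: power_divide power_mult_distrib add_divide_distrib)
  also have "\<dots> = 2 / pi" unfolding norm_jacobi_amplitude by simp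
  finally show ?thesis
  proof (rule Lim_transform_eventually)
    show "eventually (\<lambda>r. (?o r)\<^sup>2 / ?H (Suc (2 * r)) * (real (Suc (2 * r)) / real r) +
      (?e r)\<^sup>2 / ?H (2 * r) * (real (2 * r) / real r) =
      (jacobiP (Suc (2 * r)) a b 0)\<^sup>2 / jacobi_h (Suc (2 * r)) a b +
        (jacobiP (2 * r) a b 0)\<^sup>2 / jacobi_h (2 * r) a b) sequentially"
      using eventually_ge_at_top[of 1]
    proof eventually_elim
      case (elim r)
      have *: "((-1) ^ r * P * sqrt (real r))\<^sup>2 / (m * h) * (m / real r) = P\<^sup>2 / h"
        if "m > 0" "h > 0" for P h m :: real
        using that elim by (simp add: power_mult_distrib field_simps flip: power_mult)
      show ?case using elim by (subst (1 2) *) (auto simp: jacobi_h_pos[OF ab])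
    qed
  qed
qed

end

section \<open>Rate of convergence of the energy at the origin\<close>

text \<open>If \<open>p (n + 1) = - p (n - 1)\<close> held exactly, the sum of two consecutive
  squares would be constant. The relative error of order \<open>n^-2\<close> is summable with tail
  of order \<open>1 / n\<close>, and this tail is the rate.\<close>

lemma almost_antiperiodic_energy:
  fixes p :: "nat \<Rightarrow> real"
  assumes n0: "n0 \<ge> 1" and C: "C \<ge> 0"
    and step: "\<And>n. n \<ge> n0 \<Longrightarrow> \<bar>p (Suc n) + p (n - 1)\<bar> \<le> C / (real n)\<^sup>2 * (\<bar>p n\<bar> + \<bar>p (n - 1)\<bar>)"
    and lim: "(\<lambda>r. (p (Suc (2 * r)))\<^sup>2 + (p (2 * r))\<^sup>2) \<longlonglongrightarrow> L"
  obtains K where "K \<ge> 0" "\<And>n. n \<ge> n0 \<Longrightarrow> \<bar>(p n)\<^sup>2 + (p (n - 1))\<^sup>2 - L\<bar> \<le> K / real n"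
proof -
  define E where "E n = (p n)\<^sup>2 + (p (n - 1))\<^sup>2" for n
  \<comment> \<open>The increment of \<open>E\<close> factors as
    \<open>(p (Suc n) + p (n - 1)) * (p (Suc n) - p (n - 1))\<close>. The first factor is small, the
    second at most \<open>C + 2\<close> times
    \<open>\<bar>p n\<bar> + \<bar>p (n - 1)\<bar>\<close>, whose square is at most
    \<open>2 * E n\<close>.\<close>
  define D where "D = 2 * C * (C + 2)"
  have D: "D \<ge> 0" using C by (simp add: D_def)
  have E0: "E n \<ge> 0" for n by (simp add: E_def)
  have incr: "\<bar>E (Suc n) - E n\<bar> \<le> D / (real n)\<^sup>2 * E n" if n: "n \<ge> n0" for n
  proof -
    define s where "s = \<bar>p n\<bar> + \<bar>p (n - 1)\<bar>"
    define \<delta> where "\<delta> = C / (real n)\<^sup>2"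
    have n1: "real n \<ge> 1" using n n0 by simp
    have \<delta>: "0 \<le> \<delta>" "\<delta> \<le> C"
      using C n1 by (auto simp: \<delta>_def divide_le_eq mult_left_le intro!:
        mult_le_cancel_left1[THEN iffD2])
    have s0: "s \<ge> 0" by (simp add: s_def)
    have st: "\<bar>p (Suc n) + p (n - 1)\<bar> \<le> \<delta> * s" using step[OF n] by (simp add: \<delta>_def s_def)
    have "E (Suc n) - E n = (p (Suc n) + p (n - 1)) * (p (Suc n) - p (n - 1))"
      by (simp add: E_def power2_eq_square algebra_simps)
    also have "\<bar>\<dots>\<bar> = \<bar>p (Suc n) + p (n - 1)\<bar> * \<bar>p (Suc n) - p (n - 1)\<bar>" by (rule abs_mult)
    also have "\<dots> \<le> (\<delta> * s) * ((C + 2) * s)"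
    proof (intro mult_mono st)
      have "\<delta> * s \<le> C * s" using \<delta> s0 by (intro mult_right_mono) auto
      moreover have "\<bar>p (n - 1)\<bar> \<le> s" by (simp add: s_def)
      ultimately show "\<bar>p (Suc n) - p (n - 1)\<bar> \<le> (C + 2) * s" using st by (simp add: algebra_simps)
    qed (use \<delta> s0 in auto)
    also have "\<dots> = \<delta> * (C + 2) * s\<^sup>2" by (simp add: power2_eq_square)
    also have "\<dots> \<le> \<delta> * (C + 2) * (2 * E n)"
    proof (intro mult_left_mono)
      have "0 \<le> (\<bar>p n\<bar> - \<bar>p (n - 1)\<bar>)\<^sup>2" by simp
      thus "s\<^sup>2 \<le> 2 * E n" by (simp add: E_def s_def power2_eq_square algebra_simps)
    qed (use \<delta> C in auto)
    finally show ?thesis by (simp add: \<delta>_def D_def mult_ac)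
  qed
  have inv: "1 / (real n)\<^sup>2 \<le> 2 * (1 / real n - 1 / real (Suc n))" if "n \<ge> n0" for n
  proof -
    have n1: "real n \<ge> 1" using that n0 by simp
    thus ?thesis by (simp add: divide_simps power2_eq_square)
  qed
  define B where "B = E n0 * exp (2 * D)"
  \<comment> \<open>A discrete Gronwall argument: by \<open>inv\<close> the exponential factor falls
    by enough in each step to absorb the growth factor \<open>1 + D / n^2\<close>.\<close>
  have "E n * exp (2 * D / real n) \<le> E n0 * exp (2 * D / real n0)" if "n \<ge> n0" for n
    using that
  proof (induction n rule: dec_induct)
    case (step n)
    have "E (Suc n) \<le> E n * (1 + D / (real n)\<^sup>2)"
      using incr[OF step(1)] by (simp add: algebra_simps)
    also have "\<dots> \<le> E n * exp (D / (real n)\<^sup>2)"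
      by (intro mult_left_mono E0 exp_ge_add_one_self)
    finally have "E (Suc n) * exp (2 * D / real (Suc n)) \<le>
      E n * exp (D / (real n)\<^sup>2) * exp (2 * D / real (Suc n))"
      by (intro mult_right_mono) auto
    also have "\<dots> = E n * exp (D / (real n)\<^sup>2 + 2 * D / real (Suc n))"
      by (simp add: exp_add)
    also have "\<dots> \<le> E n * exp (2 * D / real n)"
    proof (intro mult_left_mono E0)
      have "D * (1 / (real n)\<^sup>2) \<le> D * (2 * (1 / real n - 1 / real (Suc n)))"
        by (intro mult_left_mono inv step D)
      hence "D / (real n)\<^sup>2 + 2 * D / real (Suc n) \<le> 2 * D / real n"
        by (simp add: algebra_simps del: of_nat_Suc)
      thus "exp (D / (real n)\<^sup>2 + 2 * D / real (Suc n)) \<le> exp (2 * D / real n)" by simp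
    qed
    finally show ?case using step.IH by linarith
  qed simp
  moreover have "E n \<le> E n * exp (2 * D / real n)" for n
    using mult_left_mono[OF _ E0[of n], of 1 "exp (2 * D / real n)"] D by simp
  moreover have "E n0 * exp (2 * D / real n0) \<le> B"
  proof -
    have "2 * D / real n0 \<le> 2 * D" using D n0
      by (simp add: divide_le_eq mult_left_le mult_le_cancel_left1)
    thus ?thesis unfolding B_def by (intro mult_left_mono E0) simp
  qed
  ultimately have E_le: "E n \<le> B" if "n \<ge> n0" for n
    using that by (meson order_trans)
  have B: "B \<ge> 0" by (simp add: B_def E0)
  have tele: "\<bar>E m - E n\<bar> \<le> 2 * D * B * (1 / real n - 1 / real m)"
    if n: "n \<ge> n0" and m: "m \<ge> n" for m n
    using m
  proof (induction m rule: dec_induct)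
    case (step m)
    have m: "m \<ge> n0" using step n by simp
    have "\<bar>E (Suc m) - E m\<bar> \<le> D / (real m)\<^sup>2 * E m" by (rule incr[OF m])
    also have "\<dots> \<le> D / (real m)\<^sup>2 * B" using E_le[OF m] D by (intro mult_left_mono) auto
    also have "\<dots> = (D * B) * (1 / (real m)\<^sup>2)" by simp
    also have "\<dots> \<le> (D * B) * (2 * (1 / real m - 1 / real (Suc m)))"
      using D B by (intro mult_left_mono inv m) auto
    finally have 1: "\<bar>E (Suc m) - E m\<bar> \<le> 2 * D * B * (1 / real m - 1 / real (Suc m))"
      by (simp add: algebra_simps del: of_nat_Suc)
    have "\<bar>E (Suc m) - E n\<bar> \<le> \<bar>E (Suc m) - E m\<bar> + \<bar>E m - E n\<bar>" by linarith
    also have "\<dots> \<le> 2 * D * B * (1 / real m - 1 / real (Suc m)) + 2 * D * B * (1 / real n -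
      1 / real m)"
      by (intro add_mono 1 step.IH)
    also have "\<dots> = 2 * D * B * (1 / real n - 1 / real (Suc m))"
      unfolding distrib_left[symmetric] by simp
    finally show ?case .
  qed simp
  have "\<bar>E n - L\<bar> \<le> 2 * D * B / real n" if n: "n \<ge> n0" for n
  proof (rule tendsto_upperbound)
    \<comment> \<open>\<open>tele\<close> compares \<open>E n\<close> with every later value, so the
      limit along the odd indices is enough.\<close>
    have "(\<lambda>r. E (Suc (2 * r))) \<longlonglongrightarrow> L" using lim by (simp add: E_def)
    thus "(\<lambda>r. \<bar>E n - E (Suc (2 * r))\<bar>) \<longlonglongrightarrow> \<bar>E n - L\<bar>" by (intro tendsto_intros)
    show "eventually (\<lambda>r. \<bar>E n - E (Suc (2 * r))\<bar> \<le> 2 * D * B / real n) sequentially"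
      using eventually_ge_at_top[of n]
    proof eventually_elim
      case (elim r)
      have "\<bar>E (Suc (2 * r)) - E n\<bar> \<le> 2 * D * B * (1 / real n - 1 / real (Suc (2 * r)))"
        using elim by (intro tele n) auto
      also have "\<dots> \<le> 2 * D * B * (1 / real n)" using D B by (intro mult_left_mono) auto
      finally show ?case by (simp add: abs_minus_commute)
    qed
  qed simp
  thus ?thesis using that[of "2 * D * B"] D B unfolding E_def by simp
qed

section \<open>Size of the recurrence coefficients and the rate\<close>

lemma rec_up_eq:
  fixes n :: nat and a b :: real
  defines "c \<equiv> 2 * real n + a + b"
  assumes "n \<ge> 1"
  shows "rec_up a b (n - 1) = (c\<^sup>2 - (a + b)\<^sup>2) / (2 * c * (c - 1))"
proof -
  have "rec_up a b (n - 1) = 2 * real n * (real n + a + b) / (c * (c - 1))"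
    using assms(2) by (simp add: rec_up_def c_def of_nat_diff algebra_simps)
  also have "2 * real n * (real n + a + b) = (c\<^sup>2 - (a + b)\<^sup>2) / 2"
    by (simp add: c_def power2_eq_square field_simps)
  finally show ?thesis by simp
qed

lemma rec_down_eq:
  fixes n :: nat and a b :: real
  defines "c \<equiv> 2 * real n + a + b"
  shows "rec_down a b n = (c\<^sup>2 - (a - b)\<^sup>2) / (2 * c * (c + 1))"
proof -
  have eq: "2 * (real n + a) * (real n + b) = (c\<^sup>2 - (a - b)\<^sup>2) / 2"
    by (simp add: c_def power2_eq_square field_simps)
  show ?thesis unfolding rec_down_def eq c_def[symmetric] by (simp add: mult.assoc)
qed

context
  fixes a b :: real
  assumes ab: "a > -1" "b > -1"
begin

lemma jacobi_c_ge:
  fixes n :: nat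
  assumes "n \<ge> 2"
  shows "2 * real n + a + b \<ge> real n" "2 * real n + a + b \<ge> 2"
proof -
  have "real n \<ge> 2" using assms by simp
  thus "2 * real n + a + b \<ge> real n" "2 * real n + a + b \<ge> 2" using ab by linarith+
qed

text \<open>In \<open>c = 2 * n + a + b\<close> the product is
  \<open>(c^2 - s^2) * (c^2 - d^2) / (4 * c^2 * (c^2 - 1))\<close>. The deviations of order
  \<open>1 / n\<close> of its two factors cancel, which leaves order \<open>n^-2\<close> and thereby
  a summable error in the recurrence.\<close>

lemma rec_bounds:
  fixes n :: nat
  assumes n: "n \<ge> 2"
  defines "s \<equiv> a + b" and "d \<equiv> a - b"
  shows "\<bar>rec_up a b (n - 1) * rec_down a b n - 1 / 4\<bar> \<le>
    (\<bar>1 - s\<^sup>2 - d\<^sup>2\<bar> + s\<^sup>2 * d\<^sup>2) / (real n)\<^sup>2" (is ?A)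
    and "\<bar>rec_mid a b n\<bar> \<le> \<bar>b\<^sup>2 - a\<^sup>2\<bar> / (real n)\<^sup>2" (is ?B)
    and "\<bar>rec_up a b (n - 1) - 1 / 2\<bar> \<le> (1 + s\<^sup>2) / real n" (is ?C)
    and "\<bar>rec_down a b n - 1 / 2\<bar> \<le> (1 + d\<^sup>2) / real n" (is ?D)
proof -
  define c where "c = 2 * real n + a + b"
  have c: "c \<ge> real n" "c \<ge> 2" "real n \<ge> 2" using jacobi_c_ge[OF n] n by (simp_all add: c_def)
  have up: "rec_up a b (n - 1) = (c\<^sup>2 - s\<^sup>2) / (2 * c * (c - 1))"
    using rec_up_eq[of n a b] n by (simp add: c_def s_def)
  have down: "rec_down a b n = (c\<^sup>2 - d\<^sup>2) / (2 * c * (c + 1))"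
    using rec_down_eq[of a b n] by (simp add: c_def d_def)
  have nn: "(real n)\<^sup>2 \<le> c\<^sup>2" using c by (intro power_mono) auto
  have c2: "c\<^sup>2 \<ge> 4" using power_mono[of 2 c 2] c by simp
  have div_le: "x / c \<le> x / real n" if "x \<ge> 0" for x
    using that c by (intro divide_left_mono mult_pos_pos) auto
  show ?A
  proof -
    define Q where "Q = \<bar>1 - s\<^sup>2 - d\<^sup>2\<bar> + s\<^sup>2 * d\<^sup>2"
    have Q: "Q \<ge> 0" by (simp add: Q_def)
    have pos: "c\<^sup>2 * (c\<^sup>2 - 1) > 0" using c2 by (intro mult_pos_pos) auto
    have nz2: "c\<^sup>2 \<noteq> 1" using c2 by auto
    have nz: "c \<noteq> 0" "c - 1 \<noteq> 0" "c + 1 \<noteq> 0" using c by auto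
    have "rec_up a b (n - 1) * rec_down a b n = (c\<^sup>2 - s\<^sup>2) * (c\<^sup>2 - d\<^sup>2) / (4 * (c\<^sup>2 * (c\<^sup>2 - 1)))"
      unfolding up down by (simp add: power2_eq_square algebra_simps)
    also have "\<dots> - 1 / 4 = (c\<^sup>2 * (1 - s\<^sup>2 - d\<^sup>2) + s\<^sup>2 * d\<^sup>2) / (4 * (c\<^sup>2 * (c\<^sup>2 - 1)))"
      using nz nz2 by (simp add: divide_simps) (simp add: algebra_simps)
    also have "\<bar>\<dots>\<bar> = \<bar>c\<^sup>2 * (1 - s\<^sup>2 - d\<^sup>2) + s\<^sup>2 * d\<^sup>2\<bar> / (4 * (c\<^sup>2 * (c\<^sup>2 - 1)))"
      using pos by (simp add: abs_divide)
    also have "\<dots> \<le> (c\<^sup>2 * Q) / (4 * (c\<^sup>2 * (c\<^sup>2 - 1)))"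
    proof (intro divide_right_mono)
      have "\<bar>c\<^sup>2 * (1 - s\<^sup>2 - d\<^sup>2) + s\<^sup>2 * d\<^sup>2\<bar> \<le> c\<^sup>2 * \<bar>1 - s\<^sup>2 - d\<^sup>2\<bar> + 1 * (s\<^sup>2 * d\<^sup>2)"
        using abs_triangle_ineq[of "c\<^sup>2 * (1 - s\<^sup>2 - d\<^sup>2)" "s\<^sup>2 * d\<^sup>2"] by (simp add: abs_mult)
      also have "\<dots> \<le> c\<^sup>2 * \<bar>1 - s\<^sup>2 - d\<^sup>2\<bar> + c\<^sup>2 * (s\<^sup>2 * d\<^sup>2)"
        using c2 by (intro add_left_mono mult_right_mono) auto
      finally show "\<bar>c\<^sup>2 * (1 - s\<^sup>2 - d\<^sup>2) + s\<^sup>2 * d\<^sup>2\<bar> \<le> c\<^sup>2 * Q" by (simp add: Q_def distrib_left)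
    qed (use pos in auto)
    also have "\<dots> = Q / (4 * (c\<^sup>2 - 1))" using nz by simp
    also have "\<dots> \<le> Q / (real n)\<^sup>2"
    proof (rule divide_left_mono[OF _ Q])
      show "(real n)\<^sup>2 \<le> 4 * (c\<^sup>2 - 1)" by (rule order_trans[OF nn]) (use c2 in argo)
      show "0 < 4 * (c\<^sup>2 - 1) * (real n)\<^sup>2" using c2 c by (intro mult_pos_pos) auto
    qed
    finally show ?A by (simp only: Q_def)
  qed
  show ?B
  proof -
    have "(real n)\<^sup>2 \<le> c * (c + 2)" using nn c by (simp add: power2_eq_square algebra_simps)
    hence "\<bar>b\<^sup>2 - a\<^sup>2\<bar> / (c * (c + 2)) \<le> \<bar>b\<^sup>2 - a\<^sup>2\<bar> / (real n)\<^sup>2"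
      using c by (intro divide_left_mono mult_pos_pos) auto
    thus ?B using c by (simp add: rec_mid_def c_def[symmetric] abs_mult)
  qed
  show ?C
  proof -
    have pos: "2 * c * (c - 1) > 0" using c by auto
    have "rec_up a b (n - 1) - 1 / 2 = (c - s\<^sup>2) / (2 * c * (c - 1))"
      unfolding up using c by (simp add: divide_simps) (simp add: power2_eq_square algebra_simps)
    also have "\<bar>\<dots>\<bar> = \<bar>c - s\<^sup>2\<bar> / (2 * c * (c - 1))" using pos by (simp only: abs_divide abs_of_pos)
    also have "\<dots> \<le> (c * (1 + s\<^sup>2)) / (2 * c * (c - 1))"
    proof (intro divide_right_mono)
      have "\<bar>c - s\<^sup>2\<bar> \<le> c + 1 * s\<^sup>2" using abs_triangle_ineq4[of c "s\<^sup>2"] c by simp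
      also have "\<dots> \<le> c + c * s\<^sup>2" using c by (intro add_left_mono mult_right_mono) auto
      finally show "\<bar>c - s\<^sup>2\<bar> \<le> c * (1 + s\<^sup>2)" by (simp add: algebra_simps)
    qed (use pos in auto)
    also have "\<dots> = (1 + s\<^sup>2) / (2 * (c - 1))" using c by simp
    also have "\<dots> \<le> (1 + s\<^sup>2) / c" using c by (intro divide_left_mono mult_pos_pos) auto
    also have "\<dots> \<le> (1 + s\<^sup>2) / real n" by (rule div_le) simp
    finally show ?C .
  qed
  show ?D
  proof -
    have pos: "2 * c * (c + 1) > 0" using c by auto
    have "rec_down a b n - 1 / 2 = - (c + d\<^sup>2) / (2 * c * (c + 1))"
      unfolding down using c by (simp add: divide_simps) (simp add: power2_eq_square algebra_simps)
    also have "\<bar>\<dots>\<bar> = (c + d\<^sup>2) / (2 * c * (c + 1))" using pos c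
      by (simp only: abs_divide abs_of_pos abs_minus) simp
    also have "\<dots> \<le> (c * (1 + d\<^sup>2)) / (2 * c * (c + 1))"
    proof (intro divide_right_mono)
      have "c + 1 * d\<^sup>2 \<le> c + c * d\<^sup>2" using c by (intro add_left_mono mult_right_mono) auto
      thus "c + d\<^sup>2 \<le> c * (1 + d\<^sup>2)" by (simp add: algebra_simps)
    qed (use pos in auto)
    also have "\<dots> = (1 + d\<^sup>2) / (2 * (c + 1))" using c by simp
    also have "\<dots> \<le> (1 + d\<^sup>2) / c" using c by (intro divide_left_mono mult_pos_pos) auto
    also have "\<dots> \<le> (1 + d\<^sup>2) / real n" by (rule div_le) simp
    finally show ?D .
  qed
qed

text \<open>Dividing by the norms turns the recurrence into that of a symmetric Jacobi matrix, whose
  off-diagonal entries are geometric means by \<open>jacobi_h_Suc\<close>. The hypothesis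
  \<open>n \<ge> 2\<close> allows this symmetry to be used at \<open>n - 1\<close> as well.\<close>

lemma jacobi_normalized_recurrence_at_0:
  fixes n :: nat
  assumes n: "n \<ge> 2"
  defines "p \<equiv> \<lambda>n. jacobiP n a b 0 / sqrt (jacobi_h n a b)"
  shows "sqrt (rec_up a b n * rec_down a b (Suc n)) * p (Suc n) + rec_mid a b n * p n
           + sqrt (rec_up a b (n - 1) * rec_down a b n) * p (n - 1) = 0"
proof -
  define X Y Z where "X = sqrt (jacobi_h (Suc n) a b)" and "Y = sqrt (jacobi_h n a b)" and "Z =
    sqrt (jacobi_h (n - 1) a b)"
  have pos: "X > 0" "Y > 0" "Z > 0" using jacobi_h_pos[OF ab] by (simp_all add: X_def Y_def Z_def)
  have sq: "X\<^sup>2 = jacobi_h (Suc n) a b" "Y\<^sup>2 = jacobi_h n a b" "Z\<^sup>2 = jacobi_h (n - 1) a b"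
    using jacobi_h_pos[OF ab, THEN less_imp_le] by (simp_all add: X_def Y_def Z_def)
  have r: "rec_up a b n > 0" "rec_down a b n > 0"
    using rec_up_pos[OF ab] rec_down_pos[OF ab] n by auto
  have 1: "rec_up a b n / Y\<^sup>2 = rec_down a b (Suc n) / X\<^sup>2"
    unfolding sq using jacobi_h_Suc[OF ab] n by simp
  have 2: "rec_up a b (n - 1) / Z\<^sup>2 = rec_down a b n / Y\<^sup>2"
    unfolding sq using jacobi_h_Suc[OF ab, of "n - 1"] n by simp
  have s1: "sqrt (rec_up a b n * rec_down a b (Suc n)) = rec_up a b n * X / Y"
  proof (rule real_sqrt_unique)
    have "rec_down a b (Suc n) = rec_up a b n / Y\<^sup>2 * X\<^sup>2" unfolding 1 using pos by simp
    thus "(rec_up a b n * X / Y)\<^sup>2 = rec_up a b n * rec_down a b (Suc n)"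
      by (simp add: power2_eq_square)
  qed (use pos r in auto)
  have s2: "sqrt (rec_up a b (n - 1) * rec_down a b n) = rec_down a b n * Z / Y"
  proof (rule real_sqrt_unique)
    have "rec_up a b (n - 1) = rec_down a b n / Y\<^sup>2 * Z\<^sup>2" unfolding 2[symmetric] using pos by simp
    thus "(rec_down a b n * Z / Y)\<^sup>2 = rec_up a b (n - 1) * rec_down a b n"
      by (simp add: power2_eq_square)
  qed (use pos r in auto)
  have "rec_up a b n * jacobiP (Suc n) a b 0 + rec_mid a b n * jacobiP n a b 0 +
    rec_down a b n * jacobiP (n - 1) a b 0 = 0"
    using jacobi_recurrence[OF ab, of n 0] n by simp
  hence "(rec_up a b n * jacobiP (Suc n) a b 0 + rec_mid a b n * jacobiP n a b 0 +
    rec_down a b n * jacobiP (n - 1) a b 0) / Y = 0"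
    by simp
  thus ?thesis unfolding s1 s2 p_def X_def[symmetric] Y_def[symmetric] Z_def[symmetric]
    using pos by (simp add: add_divide_distrib)
qed

lemma jacobi_energy_rate:
  obtains K n0 where "K \<ge> 0" "n0 \<ge> 2" "\<And>n. n \<ge> n0 \<Longrightarrow>
     \<bar>(jacobiP n a b 0)\<^sup>2 / jacobi_h n a b + (jacobiP (n - 1) a b 0)\<^sup>2 / jacobi_h (n - 1) a b -
       2 / pi\<bar> \<le> K / real n"
proof -
  define p where "p n = jacobiP n a b 0 / sqrt (jacobi_h n a b)" for n
  have p2: "(p n)\<^sup>2 = (jacobiP n a b 0)\<^sup>2 / jacobi_h n a b" for n
    using jacobi_h_pos[OF ab, of n] by (simp add: p_def power_divide)
  define Q where "Q = \<bar>1 - (a + b)\<^sup>2 - (a - b)\<^sup>2\<bar> + (a + b)\<^sup>2 * (a - b)\<^sup>2"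
  have Q: "Q \<ge> 0" by (simp add: Q_def)
  define \<alpha> where "\<alpha> n = sqrt (rec_up a b (n - 1) * rec_down a b n)" for n
  \<comment> \<open>From here on \<open>Q / n^2 \<le> 3/16\<close>, so the square of
    \<open>\<alpha> n\<close> is at least \<open>1/4 - 3/16 = 1/16\<close>.\<close>
  obtain n0 :: nat where n0: "n0 \<ge> 2" "real n0 \<ge> 16 * Q / 3"
  proof -
    obtain m :: nat where "real m > 16 * Q / 3" using reals_Archimedean2 by blast
    thus ?thesis using that[of "max 2 m"] by auto
  qed
  have prod: "rec_up a b (n - 1) * rec_down a b n > 0" if "n \<ge> 2" for n
    using rec_up_pos[OF ab, of "n - 1"] rec_down_pos[OF ab, of n] that by simp
  have \<alpha>2: "\<bar>(\<alpha> n)\<^sup>2 - 1 / 4\<bar> \<le> Q / (real n)\<^sup>2" if "n \<ge> 2" for n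
    using rec_bounds(1)[OF that] prod[OF that] by (simp add: \<alpha>_def Q_def)
  have \<alpha>_ge: "\<alpha> n \<ge> 1 / 4" if n: "n \<ge> n0" for n
  proof -
    have n2: "n \<ge> 2" "real n \<ge> 2" "real n \<ge> 16 * Q / 3" using n n0 by auto
    have "Q / (real n)\<^sup>2 \<le> Q / real n"
      using n2 Q by (intro divide_left_mono) (auto simp: power2_eq_square)
    also have "\<dots> \<le> 3 / 16" using n2 by (simp add: field_simps)
    finally have "(\<alpha> n)\<^sup>2 \<ge> 1 / 16" using \<alpha>2[OF n2(1)] by linarith
    hence "(\<alpha> n)\<^sup>2 \<ge> (1 / 4)\<^sup>2" by (simp add: power_divide)
    thus ?thesis by (rule power2_le_imp_le) (use prod[OF n2(1)] in \<open>simp add: \<alpha>_def\<close>)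
  qed
  \<comment> \<open>The outer 4 comes from dividing by \<open>\<alpha> (Suc n) \<ge> 1/4\<close>. In
    \<open>4 * Q\<close>, two deviations of at most \<open>Q / n^2\<close> are divided by
    \<open>\<alpha> (Suc n) + \<alpha> n \<ge> 1/2\<close>.\<close>
  define C where "C = 4 * (\<bar>b\<^sup>2 - a\<^sup>2\<bar> + 4 * Q)"
  have C: "C \<ge> 0" using Q by (simp add: C_def)
  have step: "\<bar>p (Suc n) + p (n - 1)\<bar> \<le> C / (real n)\<^sup>2 * (\<bar>p n\<bar> + \<bar>p (n - 1)\<bar>)" if n: "n \<ge> n0" for n
  proof -
    have n2: "n \<ge> 2" "real n \<ge> 2" using n n0 by auto
    define u where "u = 1 / (real n)\<^sup>2"
    have u: "u \<ge> 0" by (simp add: u_def)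
    have ge: "\<alpha> n \<ge> 1 / 4" "\<alpha> (Suc n) \<ge> 1 / 4" using \<alpha>_ge n by auto
    have "\<alpha> (Suc n) * p (Suc n) + rec_mid a b n * p n + \<alpha> n * p (n - 1) = 0"
      using jacobi_normalized_recurrence_at_0[OF n2(1)] by (simp add: \<alpha>_def p_def)
    \<comment> \<open>In this form only the difference of consecutive entries enters, and not the
      entries themselves.\<close>
    hence eq: "\<alpha> (Suc n) * (p (Suc n) + p (n - 1)) =
      - rec_mid a b n * p n + (\<alpha> (Suc n) - \<alpha> n) * p (n - 1)"
      by (simp add: algebra_simps)
    have mid: "\<bar>rec_mid a b n\<bar> \<le> \<bar>b\<^sup>2 - a\<^sup>2\<bar> * u" using rec_bounds(2)[OF n2(1)] by (simp add: u_def)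
    have diff: "\<bar>\<alpha> (Suc n) - \<alpha> n\<bar> \<le> 4 * Q * u"
    proof -
      have "\<bar>\<alpha> (Suc n) - \<alpha> n\<bar> * (1 / 2) \<le> \<bar>\<alpha> (Suc n) - \<alpha> n\<bar> * (\<alpha> (Suc n) + \<alpha> n)"
        using ge by (intro mult_left_mono) auto
      also have "\<dots> = \<bar>(\<alpha> (Suc n) - \<alpha> n) * (\<alpha> (Suc n) + \<alpha> n)\<bar>" using ge by (simp add: abs_mult)
      also have "(\<alpha> (Suc n) - \<alpha> n) * (\<alpha> (Suc n) + \<alpha> n) =
        ((\<alpha> (Suc n))\<^sup>2 - 1 / 4) - ((\<alpha> n)\<^sup>2 - 1 / 4)"
        by (simp add: power2_eq_square algebra_simps)
      also have "\<bar>\<dots>\<bar> \<le> Q / (real (Suc n))\<^sup>2 + Q / (real n)\<^sup>2"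
        using \<alpha>2[of n] \<alpha>2[of "Suc n"] n2 by linarith
      also have "Q / (real (Suc n))\<^sup>2 \<le> Q / (real n)\<^sup>2"
        using n2 Q by (intro divide_left_mono power_mono) auto
      finally show ?thesis by (simp add: u_def)
    qed
    have "1 / 4 * \<bar>p (Suc n) + p (n - 1)\<bar> \<le> \<alpha> (Suc n) * \<bar>p (Suc n) + p (n - 1)\<bar>"
      using ge by (intro mult_right_mono) auto
    also have "\<dots> = \<bar>- rec_mid a b n * p n + (\<alpha> (Suc n) - \<alpha> n) * p (n - 1)\<bar>"
      unfolding eq[symmetric] using ge by (simp add: abs_mult)
    also have "\<dots> \<le> \<bar>rec_mid a b n\<bar> * \<bar>p n\<bar> + \<bar>\<alpha> (Suc n) - \<alpha> n\<bar> * \<bar>p (n - 1)\<bar>"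
      using abs_triangle_ineq[of "- rec_mid a b n * p n" "(\<alpha> (Suc n) - \<alpha> n) * p (n - 1)"]
        by (simp add: abs_mult)
    also have "\<dots> \<le> ((\<bar>b\<^sup>2 - a\<^sup>2\<bar> + 4 * Q) * u) * \<bar>p n\<bar> + ((\<bar>b\<^sup>2 - a\<^sup>2\<bar> + 4 * Q) * u) * \<bar>p (n - 1)\<bar>"
    proof (intro add_mono mult_right_mono)
      show "\<bar>rec_mid a b n\<bar> \<le> (\<bar>b\<^sup>2 - a\<^sup>2\<bar> + 4 * Q) * u" using mid mult_nonneg_nonneg[OF Q u]
        by (simp add: algebra_simps)
      show "\<bar>\<alpha> (Suc n) - \<alpha> n\<bar> \<le> (\<bar>b\<^sup>2 - a\<^sup>2\<bar> + 4 * Q) * u"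
        using diff mult_nonneg_nonneg[OF _ u, of "\<bar>b\<^sup>2 - a\<^sup>2\<bar>"] by (simp add: algebra_simps)
    qed auto
    also have "\<dots> = 1 / 4 * (C / (real n)\<^sup>2 * (\<bar>p n\<bar> + \<bar>p (n - 1)\<bar>))"
      by (simp add: C_def u_def algebra_simps add_divide_distrib)
    finally show ?thesis by simp
  qed
  obtain K where "K \<ge> 0" "\<And>n. n \<ge> n0 \<Longrightarrow> \<bar>(p n)\<^sup>2 + (p (n - 1))\<^sup>2 - 2 / pi\<bar> \<le> K / real n"
    using almost_antiperiodic_energy[of n0 C p "2 / pi"] n0 C step jacobi_energy_0_tendsto[OF ab]
      unfolding p2 by auto
  thus ?thesis using that[of K n0] n0 unfolding p2 by blast
qed

text \<open>By \<open>jacobi_h_Suc\<close> the Christoffel--Darboux prefactor also equals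
  \<open>rec_up a b (n - 1) / jacobi_h (n - 1) a b\<close>. The two normalised squares thus get
  weights that are both \<open>1/2 + O(1/n)\<close>, which halves \<open>2 / pi\<close>.\<close>

lemma jacobi_cd_energy_rate:
  obtains K n0 where "K \<ge> 0" "n0 \<ge> 2" "\<And>n. n \<ge> n0 \<Longrightarrow>
     \<bar>rec_down a b n / jacobi_h n a b * ((jacobiP n a b 0)\<^sup>2 + (jacobiP (n - 1) a b 0)\<^sup>2) -
       1 / pi\<bar> \<le> K / real n"
proof -
  obtain K n0 where K: "K \<ge> 0" "n0 \<ge> 2" "\<And>n. n \<ge> n0 \<Longrightarrow>
     \<bar>(jacobiP n a b 0)\<^sup>2 / jacobi_h n a b + (jacobiP (n - 1) a b 0)\<^sup>2 / jacobi_h (n - 1) a b -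
       2 / pi\<bar> \<le> K / real n"
    using jacobi_energy_rate by blast
  define Q where "Q = 1 + (a + b)\<^sup>2 + (a - b)\<^sup>2"
  have Q: "Q \<ge> 0" by (simp add: Q_def)
  define K' where "K' = Q * (2 / pi + K) + K / 2"
  have "\<bar>rec_down a b n / jacobi_h n a b * ((jacobiP n a b 0)\<^sup>2 + (jacobiP (n - 1) a b 0)\<^sup>2) -
    1 / pi\<bar> \<le> K' / real n"
    if n: "n \<ge> n0" for n
  proof -
    have n2: "n \<ge> 2" "real n \<ge> 2" using n K(2) by auto
    define x y where "x = (jacobiP n a b 0)\<^sup>2 / jacobi_h n a b" and "y =
      (jacobiP (n - 1) a b 0)\<^sup>2 / jacobi_h (n - 1) a b"
    have xy: "x \<ge> 0" "y \<ge> 0" using jacobi_h_pos[OF ab, THEN less_imp_le]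
      by (simp_all add: x_def y_def)
    have E: "\<bar>x + y - 2 / pi\<bar> \<le> K / real n" using K(3)[OF n] by (simp add: x_def y_def)
    have "K / real n \<le> K" using K(1) n2 by (simp add: divide_le_eq mult_le_cancel_left1)
    hence xy_le: "x + y \<le> 2 / pi + K" using E by linarith
    have up: "\<bar>rec_up a b (n - 1) - 1 / 2\<bar> \<le> Q / real n"
      using rec_bounds(3)[OF n2(1)]
        by (rule order_trans) (auto simp: Q_def intro!: divide_right_mono)
    have down: "\<bar>rec_down a b n - 1 / 2\<bar> \<le> Q / real n"
      using rec_bounds(4)[OF n2(1)]
        by (rule order_trans) (auto simp: Q_def intro!: divide_right_mono)
    have "rec_up a b (n - 1) / jacobi_h (n - 1) a b = rec_down a b n / jacobi_h n a b"
      using jacobi_h_Suc[OF ab, of "n - 1"] n2 by simp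
    hence "rec_down a b n / jacobi_h n a b * ((jacobiP n a b 0)\<^sup>2 + (jacobiP (n - 1) a b 0)\<^sup>2) =
       rec_down a b n / jacobi_h n a b * (jacobiP n a b 0)\<^sup>2 + rec_up a b (n - 1) / jacobi_h (n -
         1) a b * (jacobiP (n - 1) a b 0)\<^sup>2"
      by (simp only: distrib_left)
    also have "\<dots> = rec_down a b n * x + rec_up a b (n - 1) * y" by (simp add: x_def y_def)
    finally have eq: "rec_down a b n / jacobi_h n a b * ((jacobiP n a b 0)\<^sup>2 + (jacobiP (n -
      1) a b 0)\<^sup>2) - 1 / pi
        = (rec_down a b n - 1 / 2) * x + (rec_up a b (n - 1) - 1 / 2) * y + 1 / 2 * (x + y -
          2 / pi)"
      by (simp add: algebra_simps)
    have "\<bar>(rec_down a b n - 1 / 2) * x\<bar> \<le> Q / real n * x"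
      unfolding abs_mult abs_of_nonneg[OF xy(1)] by (rule mult_right_mono[OF down xy(1)])
    moreover have "\<bar>(rec_up a b (n - 1) - 1 / 2) * y\<bar> \<le> Q / real n * y"
      unfolding abs_mult abs_of_nonneg[OF xy(2)] by (rule mult_right_mono[OF up xy(2)])
    moreover have "Q / real n * x + Q / real n * y \<le> Q / real n * (2 / pi + K)"
      unfolding distrib_left[symmetric] using xy_le Q by (intro mult_left_mono) auto
    moreover have "\<bar>1 / 2 * (x + y - 2 / pi)\<bar> \<le> K / 2 / real n" using E by (simp add: abs_mult)
    moreover have "K' / real n = Q / real n * (2 / pi + K) + K / 2 / real n"
      by (simp add: K'_def add_divide_distrib)
    ultimately show ?thesis unfolding eq by linarith
  qed
  moreover have "K' \<ge> 0" using Q K(1) by (simp add: K'_def)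
  ultimately show ?thesis using that[of K' n0] K(2) by blast
qed

end

section \<open>Scaling limit\<close>

definition jacobi_weight :: "real \<Rightarrow> real \<Rightarrow> real \<Rightarrow> real" where
  "jacobi_weight a b x = (1 - x) powr (a / 2) * (1 + x) powr (b / 2)"

lemma jacobi_weight_has_derivative:
  assumes "\<bar>x\<bar> < 1"
  shows "(jacobi_weight a b has_real_derivative
            jacobi_weight a b x * (b - a - (a + b) * x) / (2 * (1 - x\<^sup>2))) (at x)"
proof -
  have pos: "1 - x > 0" "1 + x > 0" using assms by auto
  have sq: "1 - x\<^sup>2 = (1 - x) * (1 + x)" by (simp add: power2_eq_square algebra_simps)
  have p1: "(1 - x) powr (a / 2 - 1) = (1 - x) powr (a / 2) / (1 - x)"
    and p2: "(1 + x) powr (b / 2 - 1) = (1 + x) powr (b / 2) / (1 + x)" using pos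
      by (simp_all add: powr_diff)
  have "(jacobi_weight a b has_real_derivative
     - (a / 2 * (1 - x) powr (a / 2 - 1)) * (1 + x) powr (b / 2) + (1 -
       x) powr (a / 2) * (b / 2 * (1 + x) powr (b / 2 - 1))) (at x)"
    unfolding jacobi_weight_def using pos
    by (auto intro!: derivative_eq_intros DERIV_fun_powr[THEN DERIV_cong])
  also have "- (a / 2 * (1 - x) powr (a / 2 - 1)) * (1 + x) powr (b / 2) + (1 -
    x) powr (a / 2) * (b / 2 * (1 + x) powr (b / 2 - 1))
     = jacobi_weight a b x * (b - a - (a + b) * x) / (2 * (1 - x\<^sup>2))"
    unfolding p1 p2 sq jacobi_weight_def using pos
      by (simp add: divide_simps) (simp add: algebra_simps)
  finally show ?thesis .
qed

context
  fixes a b :: real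
  assumes ab: "a > -1" "b > -1"
begin

lemma jacobi_kernel_cd:
  assumes N: "N \<ge> 1"
  shows "(x - y) * jacobi_kernel N a b x y = rec_down a b N / jacobi_h N a b *
     ((jacobiP N a b x * jacobi_weight a b x) * (jacobiP (N - 1) a b y * jacobi_weight a b y) -
      (jacobiP (N - 1) a b x * jacobi_weight a b x) * (jacobiP N a b y * jacobi_weight a b y))"
proof -
  have "jacobi_phi j a b x * jacobi_phi j a b y = (jacobi_weight a b x * jacobi_weight a b y) *
      (jacobiP j a b x * jacobiP j a b y / jacobi_h j a b)" for j
    using jacobi_h_pos[OF ab, of j] by (simp add: jacobi_phi_def jacobi_weight_def mult_ac)
  hence "jacobi_kernel N a b x y = (jacobi_weight a b x * jacobi_weight a b y) *
      (\<Sum>j<N. jacobiP j a b x * jacobiP j a b y / jacobi_h j a b)"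
    by (simp add: jacobi_kernel_def sum_distrib_left)
  hence "(x - y) * jacobi_kernel N a b x y = (jacobi_weight a b x * jacobi_weight a b y) *
      ((x - y) * (\<Sum>j<N. jacobiP j a b x * jacobiP j a b y / jacobi_h j a b))"
    by simp
  also have "\<dots> = (jacobi_weight a b x * jacobi_weight a b y) * (rec_down a b N / jacobi_h N a b *
       (jacobiP N a b x * jacobiP (N - 1) a b y - jacobiP (N - 1) a b x * jacobiP N a b y))"
    unfolding jacobi_christoffel_darboux[OF ab N] ..
  also have "\<dots> = rec_down a b N / jacobi_h N a b *
     ((jacobiP N a b x * jacobi_weight a b x) * (jacobiP (N - 1) a b y * jacobi_weight a b y) -
      (jacobiP (N - 1) a b x * jacobi_weight a b x) * (jacobiP N a b y * jacobi_weight a b y))"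
    by (simp only: right_diff_distrib mult_ac)
  finally show ?thesis .
qed

text \<open>The weight makes the first-order system traceless.\<close>

lemma jacobi_weighted_system:
  fixes n :: nat and x :: real
  assumes n: "n \<ge> 1" and x: "\<bar>x\<bar> < 1"
  defines "c \<equiv> 2 * real n + a + b"
  defines "f \<equiv> \<lambda>x. jacobiP n a b x * jacobi_weight a b x"
    and "g \<equiv> \<lambda>x. jacobiP (n - 1) a b x * jacobi_weight a b x"
    and "A \<equiv> (a\<^sup>2 - b\<^sup>2) / (2 * c) + c * x / 2"
  shows "(f has_real_derivative
    (2 * (real n + a) * (real n + b) / c * g x - A * f x) / (1 - x\<^sup>2)) (at x)"
    and "(g has_real_derivative
      (A * g x - 2 * real n * (real n + a + b) / c * f x) / (1 - x\<^sup>2)) (at x)"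
proof -
  obtain m where m: "n = Suc m" using n by (cases n) auto
  have c: "c > 0" using ab n by (simp add: c_def m)
  have x2: "1 - x\<^sup>2 > 0" using x by (simp add: abs_square_less_1)
  define P0 P1 w where "P0 = jacobiP m a b x" and "P1 = jacobiP n a b x" and "w =
    jacobi_weight a b x"
  define D1 D0 where "D1 = jacobi_deriv n a b x" and "D0 = jacobi_deriv m a b x"
  define W where "W = jacobi_weight a b x * (b - a - (a + b) * x) / (2 * (1 - x\<^sup>2))"
  have A: "c * ((1 - x\<^sup>2) * D1) =
    real n * (a - b - c * x) * P1 + 2 * (real n + a) * (real n + b) * P0"
    using jacobi_structure_lower[OF ab, of m x] by (simp only: c_def D1_def P0_def P1_def m)
  have B: "c * ((1 - x\<^sup>2) * D0) = (real n + a + b) * ((a - b + c * x) * P0 - 2 * real n * P1)"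
    using jacobi_structure_upper[OF ab, of m x] by (simp only: c_def D0_def P0_def P1_def m)
  have W: "(1 - x\<^sup>2) * W = w * (b - a - (a + b) * x) / 2"
  proof -
    have "r * (u / (2 * r)) = u / 2" if "r > 0" for r u :: real using that by simp
    from this[OF x2] show ?thesis by (simp only: W_def w_def)
  qed
  have divide_aux: "z = e / q" if "c * (q * z) = c * e" "q > 0" for z e q :: real
    using that c by (auto simp: eq_divide_eq mult.commute)
  have cA: "c * A = (a\<^sup>2 - b\<^sup>2) / 2 + c\<^sup>2 * x / 2"
    using c by (simp add: A_def distrib_left power2_eq_square)
  have "(f has_real_derivative (D1 * w + P1 * W)) (at x)"
    unfolding f_def D1_def P1_def w_def W_def
    using DERIV_mult'[OF jacobiP_has_derivative jacobi_weight_has_derivative[OF x]]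
      by (simp add: add.commute)
  also have "D1 * w + P1 * W = (2 * (real n + a) * (real n + b) / c * g x - A * f x) / (1 - x\<^sup>2)"
  proof -
    have "c * ((1 - x\<^sup>2) * (D1 * w + P1 * W)) =
      (c * ((1 - x\<^sup>2) * D1)) * w + c * P1 * ((1 - x\<^sup>2) * W)"
      by (simp add: algebra_simps)
    \<comment> \<open>The coefficient of \<open>P1 * w\<close> is
      \<open>(a - b) * (n - c / 2) - c * x * (n + (a + b) / 2)\<close>, which equals
      \<open>- c * A\<close> because \<open>2 * n + a + b = c\<close>.\<close>
    also have "\<dots> = 2 * (real n + a) * (real n + b) * (P0 * w) - (c * A) * (P1 * w)"
      unfolding A W cA by (simp add: c_def power2_eq_square field_simps)
    also have "\<dots> = c * (2 * (real n + a) * (real n + b) / c * g x - A * f x)"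
      using c by (simp add: f_def g_def m P0_def P1_def w_def right_diff_distrib)
    finally show ?thesis by (rule divide_aux[OF _ x2])
  qed
  finally show "(f has_real_derivative
    (2 * (real n + a) * (real n + b) / c * g x - A * f x) / (1 - x\<^sup>2)) (at x)" .
  have "(g has_real_derivative (D0 * w + P0 * W)) (at x)"
    unfolding g_def D0_def P0_def w_def W_def m
    using DERIV_mult'[OF jacobiP_has_derivative jacobi_weight_has_derivative[OF x]]
      by (simp add: add.commute)
  also have "D0 * w + P0 * W = (A * g x - 2 * real n * (real n + a + b) / c * f x) / (1 - x\<^sup>2)"
  proof -
    have "c * ((1 - x\<^sup>2) * (D0 * w + P0 * W)) =
      (c * ((1 - x\<^sup>2) * D0)) * w + c * P0 * ((1 - x\<^sup>2) * W)"
      by (simp add: algebra_simps)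
    also have "\<dots> = (c * A) * (P0 * w) - 2 * real n * (real n + a + b) * (P1 * w)"
      unfolding B W cA by (simp add: c_def power2_eq_square field_simps)
    also have "\<dots> = c * (A * g x - 2 * real n * (real n + a + b) / c * f x)"
      using c by (simp add: f_def g_def m P0_def P1_def w_def right_diff_distrib)
    finally show ?thesis by (rule divide_aux[OF _ x2])
  qed
  finally show "(g has_real_derivative
    (A * g x - 2 * real n * (real n + a + b) / c * f x) / (1 - x\<^sup>2)) (at x)" .
qed

text \<open>At argument \<open>t / N\<close> the off-diagonal entries of the system are
  \<open>1 + O(1/N)\<close> and \<open>-1 + O(1/N)\<close>, and the diagonal ones are
  \<open>O(1/N)\<close>, uniformly for \<open>\<bar>t\<bar> \<le> R\<close>. The condition
  \<open>real N \<ge> 2 * R\<close> keeps \<open>t / N\<close> away from the endpoints, and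
  \<open>real N \<ge> K\<close> makes the relative error at most 1.\<close>

lemma jacobi_scaled_cross_bound:
  fixes R :: real and N :: nat
  defines "K \<equiv> 2 * (\<bar>a\<^sup>2 - b\<^sup>2\<bar> + (2 + \<bar>a + b\<bar>) * R + \<bar>a + b\<bar> + 2 * \<bar>a * b\<bar> + R\<^sup>2)"
  defines "f \<equiv> \<lambda>t. jacobiP N a b (t / real N) * jacobi_weight a b (t / real N)"
    and "g \<equiv> \<lambda>t. jacobiP (N - 1) a b (t / real N) * jacobi_weight a b (t / real N)"
  assumes R: "R \<ge> 0" and N: "N \<ge> 2" "real N \<ge> 2 * R" "real N \<ge> K" and x: "\<bar>x\<bar> \<le> R" and y: "\<bar>y\<bar> \<le> R"
  defines "M0 \<equiv> (jacobiP N a b 0)\<^sup>2 + (jacobiP (N - 1) a b 0)\<^sup>2"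
  shows "\<bar>f x * g y - g x * f y - M0 * sin (x - y)\<bar> \<le>
    4 * exp (4 * R) * (1 + 3 * R) * (K / real N) * M0 * \<bar>x - y\<bar>"
proof -
  define c where "c = 2 * real N + a + b"
  have Npos: "real N \<ge> 2" using N by simp
  have c: "c \<ge> real N" "c \<ge> 2" using jacobi_c_ge[OF ab N(1)] by (simp_all add: c_def)
  define A where "A t = (a\<^sup>2 - b\<^sup>2) / (2 * c) + c * (t / real N) / 2" for t
  define B where "B = 2 * (real N + a) * (real N + b) / c"
  define D where "D = 2 * real N * (real N + a + b) / c"
  define q where "q t = 1 - (t / real N)\<^sup>2" for t
  define f' where "f' t = (B * g t - A t * f t) / q t / real N" for t
  define g' where "g' t = (A t * g t - D * f t) / q t / real N" for t
  \<comment> \<open>\<open>K / 2\<close> will bound \<open>A t\<close> and the deviations of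
    \<open>B\<close> and \<open>D\<close> from \<open>real N * q t\<close>; division by
    \<open>q t \<ge> 1/2\<close> doubles it, and the inner derivative contributes
    \<open>1 / real N\<close>.\<close>
  define e where "e = K / real N"
  have K: "K \<ge> 0" using R by (simp add: K_def)
  have e: "0 \<le> e" "e \<le> 1" using K N Npos by (simp_all add: e_def)
  have small: "\<bar>t / real N\<bar> \<le> 1 / 2" if "\<bar>t\<bar> \<le> R" for t
    using that N Npos by (simp add: abs_divide divide_simps)
  have q: "q t \<ge> 3 / 4" "q t > 0" if "\<bar>t\<bar> \<le> R" for t
  proof -
    have "\<bar>t / real N\<bar>\<^sup>2 \<le> (1 / 2)\<^sup>2" by (intro power_mono small that) simp
    hence "(t / real N)\<^sup>2 \<le> 1 / 4" by (simp add: power_divide)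
    thus "q t \<ge> 3 / 4" "q t > 0" by (simp_all add: q_def)
  qed
  have df: "(f has_real_derivative f' t) (at t)" and dg: "(g has_real_derivative g' t) (at t)"
    if t: "\<bar>t\<bar> \<le> R" for t
  proof -
    have lt: "\<bar>t / real N\<bar> < 1" using small[OF t] by linarith
    have sc: "((\<lambda>t. t / real N) has_real_derivative 1 / real N) (at t)"
      using Npos by (auto intro!: derivative_eq_intros)
    have N1: "N \<ge> 1" using N by simp
    note sys = jacobi_weighted_system[OF N1 lt]
    show "(f has_real_derivative f' t) (at t)"
      using DERIV_chain2[OF sys(1) sc] unfolding f_def f'_def A_def B_def q_def g_def c_def by simp
    show "(g has_real_derivative g' t) (at t)"
      using DERIV_chain2[OF sys(2) sc] unfolding f_def g'_def A_def D_def q_def g_def c_def by simp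
  qed
  have est: "\<bar>z / q t / real N\<bar> \<le> e" if t: "\<bar>t\<bar> \<le> R" and z: "\<bar>z\<bar> \<le> K / 2" for t z
  proof -
    have "\<bar>z / q t / real N\<bar> = \<bar>z\<bar> / q t / real N" using q[OF t] Npos by (simp add: abs_divide)
    also have "\<dots> \<le> (K / 2) / (1 / 2) / real N"
      using q[OF t] z Npos K by (intro divide_right_mono frac_le) auto
    finally show ?thesis by (simp add: e_def)
  qed
  have A: "\<bar>A t\<bar> \<le> K / 2" if t: "\<bar>t\<bar> \<le> R" for t
  proof -
    have "\<bar>(a\<^sup>2 - b\<^sup>2) / (2 * c)\<bar> \<le> \<bar>a\<^sup>2 - b\<^sup>2\<bar> / 1"
      unfolding abs_divide using c by (intro frac_le) auto
    moreover have "\<bar>c * (t / real N) / 2\<bar> \<le> (2 + \<bar>a + b\<bar>) * R"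
    proof -
      have "c / real N \<le> 2 + \<bar>a + b\<bar>"
      proof -
        have "\<bar>a + b\<bar> * 1 \<le> \<bar>a + b\<bar> * real N" using Npos by (intro mult_left_mono) auto
        hence "c \<le> (2 + \<bar>a + b\<bar>) * real N" by (simp add: c_def algebra_simps)
        thus ?thesis using Npos by (simp add: divide_le_eq)
      qed
      hence "c / real N * \<bar>t\<bar> \<le> (2 + \<bar>a + b\<bar>) * R" using t by (intro mult_mono) auto
      moreover have "\<bar>c * (t / real N) / 2\<bar> = c / real N * \<bar>t\<bar> / 2" using c by (simp add: abs_mult)
      moreover have "z / 2 \<le> z" if "z \<ge> 0" for z :: real using that by simp
      moreover have "0 \<le> c / real N * \<bar>t\<bar>" using c by simp
      ultimately show ?thesis by (metis order_trans)
    qed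
    moreover have "K / 2 = \<bar>a\<^sup>2 - b\<^sup>2\<bar> + (2 + \<bar>a + b\<bar>) * R + (\<bar>a + b\<bar> + 2 * \<bar>a * b\<bar> + R\<^sup>2)"
      by (simp add: K_def)
    moreover have "\<bar>a + b\<bar> + 2 * \<bar>a * b\<bar> + R\<^sup>2 \<ge> 0" by simp
    moreover have "\<bar>p + q\<bar> \<le> k" if "\<bar>p\<bar> \<le> k1 / 1" "\<bar>q\<bar> \<le> k2" "k = k1 + k2 + k3" "0 \<le> k3"
      for p q k k1 k2 k3 :: real using that by linarith
    ultimately show ?thesis unfolding A_def by blast
  qed
  have NX: "\<bar>real N * (t / real N)\<^sup>2\<bar> \<le> R\<^sup>2" if t: "\<bar>t\<bar> \<le> R" for t
  proof -
    have "real N * (t / real N)\<^sup>2 = t\<^sup>2 / real N" using Npos by (simp add: power2_eq_square)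
    also have "\<dots> \<le> R\<^sup>2 / 1" using abs_le_square_iff[of t R] t R Npos by (intro frac_le) auto
    finally show ?thesis by simp
  qed
  have KR: "\<bar>a + b\<bar> + 2 * \<bar>a * b\<bar> + R\<^sup>2 \<le> K / 2" using R by (simp add: K_def)
  have Bq: "\<bar>B - real N * q t\<bar> \<le> K / 2" if t: "\<bar>t\<bar> \<le> R" for t
  proof -
    \<comment> \<open>As \<open>2 * (N + a) * (N + b) - N * c = (a + b) * N + 2 * a * b\<close>, the
      deviation stays bounded as \<open>N\<close> grows.\<close>
    have "B - real N = (a + b) * (real N / c) + 2 * (a * b) / c"
      using c unfolding B_def by (simp add: divide_simps) (simp add: c_def algebra_simps)
    moreover have "\<bar>(a + b) * (real N / c)\<bar> \<le> \<bar>a + b\<bar> * 1"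
      unfolding abs_mult using c by (intro mult_left_mono) auto
    moreover have "\<bar>2 * (a * b) / c\<bar> \<le> 2 * \<bar>a * b\<bar> / 1"
      unfolding abs_divide using c by (intro frac_le) (auto simp: abs_mult)
    moreover have "B - real N * q t = (B - real N) + real N * (t / real N)\<^sup>2"
      by (simp add: q_def algebra_simps)
    moreover have "\<bar>(p + q) + z\<bar> \<le> k" if "\<bar>p\<bar> \<le> k1 * 1" "\<bar>q\<bar> \<le> k2 / 1" "\<bar>z\<bar> \<le> k3" "k1 + k2 + k3 \<le> k"
      for p q z k k1 k2 k3 :: real using that by linarith
    ultimately show ?thesis using NX[OF t] KR by metis
  qed
  have Dq: "\<bar>D - real N * q t\<bar> \<le> K / 2" if t: "\<bar>t\<bar> \<le> R" for t
  proof -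
    have "D - real N = (a + b) * (real N / c)"
      using c unfolding D_def by (simp add: divide_simps) (simp add: c_def algebra_simps)
    moreover have "\<bar>(a + b) * (real N / c)\<bar> \<le> \<bar>a + b\<bar> * 1"
      unfolding abs_mult using c by (intro mult_left_mono) auto
    moreover have "D - real N * q t = (D - real N) + real N * (t / real N)\<^sup>2"
      by (simp add: q_def algebra_simps)
    moreover have "2 * \<bar>a * b\<bar> \<ge> 0" by simp
    moreover have "\<bar>p + z\<bar> \<le> k" if "\<bar>p\<bar> \<le> k1 * 1" "0 \<le> k2" "\<bar>z\<bar> \<le> k3" "k1 + k2 + k3 \<le> k"
      for p z k k1 k2 k3 :: real using that by linarith
    ultimately show ?thesis using NX[OF t] KR by metis
  qed
  have comb: "\<bar>u * v + w * z\<bar> \<le> e * (\<bar>v\<bar> + \<bar>z\<bar>)" if "\<bar>u\<bar> \<le> e" "\<bar>w\<bar> \<le> e" for u v w z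
  proof -
    have "\<bar>u * v + w * z\<bar> \<le> \<bar>u\<bar> * \<bar>v\<bar> + \<bar>w\<bar> * \<bar>z\<bar>" using abs_triangle_ineq[of "u * v" "w * z"]
      by (simp add: abs_mult)
    also have "\<dots> \<le> e * \<bar>v\<bar> + e * \<bar>z\<bar>" using that by (intro add_mono mult_right_mono) auto
    finally show ?thesis by (simp add: distrib_left)
  qed
  have f': "\<bar>f' t - g t\<bar> \<le> e * (\<bar>f t\<bar> + \<bar>g t\<bar>)" if t: "\<bar>t\<bar> \<le> R" for t
  proof -
    have "f' t - g t = (- A t / q t / real N) * f t + ((B - real N * q t) / q t / real N) * g t"
      using q(2)[OF t] Npos by (simp add: f'_def divide_simps) (simp add: algebra_simps)
    thus ?thesis using comb[OF est[OF t, of "- A t"] est[OF t Bq[OF t]]] A[OF t] by simp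
  qed
  have g': "\<bar>g' t + f t\<bar> \<le> e * (\<bar>f t\<bar> + \<bar>g t\<bar>)" if t: "\<bar>t\<bar> \<le> R" for t
  proof -
    have "g' t + f t = (- (D - real N * q t) / q t / real N) * f t + (A t / q t / real N) * g t"
      using q(2)[OF t] Npos by (simp add: g'_def divide_simps) (simp add: algebra_simps)
    moreover have "\<bar>- (D - real N * q t)\<bar> \<le> K / 2" using Dq[OF t] by (simp only: abs_minus_cancel)
    ultimately show ?thesis using comb[OF est[OF t] est[OF t A[OF t]]] by (simp only:)
  qed
  have "jacobi_weight a b 0 = 1" by (simp add: jacobi_weight_def)
  hence "(f 0)\<^sup>2 + (g 0)\<^sup>2 = M0" by (simp add: f_def g_def M0_def)
  thus ?thesis using perturbed_rotation_cross_bound[of R f f' g g', OF df dg f' g' e x y]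
    by (simp add: e_def)
qed

end

section \<open>Passage to the diagonal and conclusion\<close>

lemma sine_kernel_tendsto_diagonal: "(sine_kernel x \<longlongrightarrow> sine_kernel x x) (at x)"
proof -
  have "((\<lambda>h. sin h / h) \<longlongrightarrow> 1) (at (0::real))"
    using DERIV_sin[of 0] by (simp add: DERIV_def)
  moreover have "filterlim (\<lambda>y. x - y) (at 0) (at x)"
    by (auto simp: filterlim_at eventually_at_filter intro!: tendsto_eq_intros)
  ultimately have "((\<lambda>y. sin (x - y) / (x - y)) \<longlongrightarrow> 1) (at x)"
    by (rule filterlim_compose)
  hence "((\<lambda>y. sin (x - y) / (x - y) / pi) \<longlongrightarrow> 1 / pi) (at x)"
    by (intro tendsto_intros) auto
  moreover have "eventually (\<lambda>y. sin (x - y) / (x - y) / pi = sine_kernel x y) (at x)"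
    by (auto simp: eventually_at_filter sine_kernel_def mult.commute)
  ultimately show ?thesis
    by (simp add: sine_kernel_def Lim_transform_eventually)
qed

text \<open>The hypothesis keeps both bases \<open>1 - y\<close> and \<open>1 + y\<close> positive,
  so the real powers are continuous for exponents of either sign.\<close>

lemma isCont_jacobi_kernel:
  assumes "\<bar>y\<bar> < 1"
  shows "isCont (jacobi_kernel N a b x) y"
proof -
  have P: "isCont (jacobiP j a b) y" for j
    using jacobiP_has_derivative by (rule DERIV_isCont)
  have phi: "isCont (\<lambda>y. jacobiP j a b y * (1 - y) powr (a / 2) * (1 +
    y) powr (b / 2) / sqrt (jacobi_h j a b)) y" for j
    unfolding divide_inverse using assms by (intro continuous_intros P) auto
  show ?thesis
    unfolding jacobi_kernel_def[abs_def]
      by (intro continuous_sum continuous_mult continuous_const phi[folded jacobi_phi_def])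
qed

theorem theorem1:
  fixes a b :: real and S :: "real set"
  assumes "a > -1" and "b > -1" and "compact S"
  shows "\<exists>C. \<forall>\<^sub>F N in sequentially. \<forall>x\<in>S. \<forall>y\<in>S.
           \<bar>jacobi_kernel N a b (x / real N) (y / real N) / real N - sine_kernel x y\<bar>
             \<le> C / real N"
proof -
  note ab = assms(1,2)
  obtain r where r: "\<And>x. x \<in> S \<Longrightarrow> \<bar>x\<bar> \<le> r"
    using compact_imp_bounded[OF assms(3)] by (auto simp: bounded_iff)
  \<comment> \<open>The extra 1 puts \<open>S\<close> strictly inside \<open>{-R<..<R}\<close>. On
    the diagonal a point of \<open>S\<close> is approached by points which may lie outside
    \<open>S\<close>, and the estimate must hold for them too.\<close>
  define R where "R = max r 0 + 1"
  have R: "R \<ge> 0" and S: "\<And>x. x \<in> S \<Longrightarrow> \<bar>x\<bar> < R" using r by (force simp: R_def)+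
  define K where "K = 2 * (\<bar>a\<^sup>2 - b\<^sup>2\<bar> + (2 + \<bar>a + b\<bar>) * R + \<bar>a + b\<bar> + 2 * \<bar>a * b\<bar> + R\<^sup>2)"
  have K: "K \<ge> 0" using R by (simp add: K_def)
  obtain L n0 where L: "L \<ge> 0" "n0 \<ge> 2" and rate: "\<And>n. n \<ge> n0 \<Longrightarrow>
     \<bar>rec_down a b n / jacobi_h n a b * ((jacobiP n a b 0)\<^sup>2 + (jacobiP (n - 1) a b 0)\<^sup>2) -
       1 / pi\<bar> \<le> L / real n"
    using jacobi_cd_energy_rate[OF ab] by blast
  define k where "k = 4 * exp (4 * R) * (1 + 3 * R) * K"
  have k: "k \<ge> 0" using R K by (simp add: k_def)
  \<comment> \<open>The rotation error contributes \<open>k / N\<close> times the normalised energy,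
    which is at most \<open>1 / pi + L\<close>; the error of that energy contributes
    \<open>L / N\<close>.\<close>
  define C where "C = k * (1 / pi + L) + L"
  define err where "err N x y =
    \<bar>jacobi_kernel N a b (x / real N) (y / real N) / real N - sine_kernel x y\<bar>" for N x y
  obtain n1 :: nat where n1: "real n1 > max (2 * R) K" using reals_Archimedean2 by blast
  have main: "err N x y \<le> C / real N"
    if N: "N \<ge> max n0 n1" and x: "\<bar>x\<bar> \<le> R" and y: "\<bar>y\<bar> \<le> R" and "x \<noteq> y" for N x y
  proof -
    have N2: "N \<ge> n0" "N \<ge> 2" "N \<ge> 1" "real N \<ge> 2 * R" "real N \<ge> K" "real N \<ge> 2"
      using N n1 L(2) by auto
    define \<kappa> where "\<kappa> = rec_down a b N / jacobi_h N a b"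
    have \<kappa>: "\<kappa> > 0" using rec_down_pos[OF ab N2(3)] jacobi_h_pos[OF ab] by (simp add: \<kappa>_def)
    define M0 where "M0 = (jacobiP N a b 0)\<^sup>2 + (jacobiP (N - 1) a b 0)\<^sup>2"
    define f g where "f t = jacobiP N a b (t / real N) * jacobi_weight a b (t / real N)"
      and "g t = jacobiP (N - 1) a b (t / real N) * jacobi_weight a b (t / real N)" for t
    define s where "s = f x * g y - g x * f y"
    have "\<bar>s - M0 * sin (x - y)\<bar> \<le> 4 * exp (4 * R) * (1 + 3 * R) * (K / real N) * M0 * \<bar>x - y\<bar>"
      unfolding s_def f_def g_def M0_def K_def
      by (rule jacobi_scaled_cross_bound[OF ab R N2(2,4) _ x y]) (use N2(5) in \<open>simp only: K_def\<close>)
    also have "\<dots> = k / real N * M0 * \<bar>x - y\<bar>" by (simp add: k_def)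
    finally have s: "\<bar>s - M0 * sin (x - y)\<bar> \<le> k / real N * M0 * \<bar>x - y\<bar>" .
    have m: "\<bar>\<kappa> * M0 - 1 / pi\<bar> \<le> L / real N" using rate[OF N2(1)] by (simp add: \<kappa>_def M0_def)
    have "L / real N \<le> L" using L(1) N2 by (simp add: divide_le_eq mult_le_cancel_left1)
    hence m': "\<kappa> * M0 \<le> 1 / pi + L" using m by linarith
    have ker: "(x - y) * (jacobi_kernel N a b (x / real N) (y / real N) / real N) = \<kappa> * s"
    proof -
      have "(x - y) * (jacobi_kernel N a b (x / real N) (y / real N) / real N) =
        (x / real N - y / real N) * jacobi_kernel N a b (x / real N) (y / real N)"
        by (simp add: diff_divide_distrib[symmetric])
      also have "\<dots> = \<kappa> * s" unfolding jacobi_kernel_cd[OF ab N2(3)]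
        by (simp add: \<kappa>_def s_def f_def g_def)
      finally show ?thesis .
    qed
    have "(x - y) * sine_kernel x y = sin (x - y) / pi" using \<open>x \<noteq> y\<close> by (simp add: sine_kernel_def)
    \<comment> \<open>The error splits into that of the rotation and that of the energy at the
      origin. Both carry a factor \<open>\<bar>x - y\<bar>\<close>, the second one through the sine,
      so it can be cancelled.\<close>
    hence "(x - y) * (jacobi_kernel N a b (x / real N) (y / real N) / real N - sine_kernel x y)
        = \<kappa> * (s - M0 * sin (x - y)) + (\<kappa> * M0 - 1 / pi) * sin (x - y)"
      unfolding right_diff_distrib ker by (simp add: algebra_simps)
    hence "\<bar>x - y\<bar> * err N x y = \<bar>\<kappa> * (s - M0 * sin (x - y)) + (\<kappa> * M0 - 1 / pi) * sin (x - y)\<bar>"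
      by (simp add: err_def flip: abs_mult)
    also have "\<dots> \<le> \<kappa> * \<bar>s - M0 * sin (x - y)\<bar> + \<bar>\<kappa> * M0 - 1 / pi\<bar> * \<bar>sin (x - y)\<bar>"
      using abs_triangle_ineq[of "\<kappa> * (s - M0 * sin (x - y))" "(\<kappa> * M0 - 1 / pi) * sin (x - y)"] \<kappa>
        by (simp add: abs_mult)
    also have "\<dots> \<le> \<kappa> * (k / real N * M0 * \<bar>x - y\<bar>) + L / real N * \<bar>x - y\<bar>"
      using s m \<kappa> L(1) abs_sin_x_le_abs_x[of "x - y"] by (intro add_mono mult_mono) auto
    also have "\<dots> = \<bar>x - y\<bar> * (k / real N * (\<kappa> * M0) + L / real N)" by (simp add: algebra_simps)
    finally have "err N x y \<le> k / real N * (\<kappa> * M0) + L / real N" using \<open>x \<noteq> y\<close> by simp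
    also have "\<dots> \<le> k / real N * (1 / pi + L) + L / real N"
      using m' k by (intro add_right_mono mult_left_mono) auto
    also have "\<dots> = C / real N" by (simp add: C_def add_divide_distrib)
    finally show ?thesis .
  qed
  have "err N x y \<le> C / real N" if N: "N \<ge> max n0 n1" and x: "x \<in> S" and y: "y \<in> S" for N x y
  proof (cases "x = y")
    case False
    show ?thesis by (rule main[OF N]) (use S[OF x] S[OF y] False in auto)
  next
    case True
    have N2: "real N \<ge> 2 * R" "real N \<ge> 2" using N n1 L(2) by auto
    have "\<bar>x / real N\<bar> < 1" using S[OF x] N2 by (simp add: abs_divide)
    hence cont: "isCont (jacobi_kernel N a b (x / real N)) (x / real N)"
      by (rule isCont_jacobi_kernel)
    have "isCont (\<lambda>y. y / real N) x" using N2 by (intro continuous_intros) auto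
    hence "isCont (\<lambda>y. jacobi_kernel N a b (x / real N) (y / real N)) x"
      using cont by (rule isCont_o2)
    hence "((\<lambda>y. jacobi_kernel N a b (x / real N) (y / real N)) \<longlongrightarrow> jacobi_kernel N a b (x / real N)
      (x / real N)) (at x)"
      by (simp add: isCont_def)
    \<comment> \<open>For fixed \<open>N\<close> the error is continuous in \<open>y\<close> at
      \<open>x\<close>, and the bound from \<open>main\<close> does not depend on \<open>y\<close>,
      so it survives the limit.\<close>
    hence "((err N x) \<longlongrightarrow> err N x x) (at x)"
      unfolding err_def using N2 by (intro tendsto_intros sine_kernel_tendsto_diagonal) auto
    moreover have "eventually (\<lambda>y. err N x y \<le> C / real N) (at x)"
    proof -
      have "eventually (\<lambda>y. y \<in> {-R<..<R}) (at x)"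
        using S[OF x] by (intro eventually_at_in_open') auto
      moreover have "eventually (\<lambda>y. y \<noteq> x) (at x)" by (simp add: eventually_at_filter)
      ultimately show ?thesis
      proof eventually_elim
        case (elim y)
        show ?case by (rule main[OF N]) (use elim S[OF x] in auto)
      qed
    qed
    ultimately have "err N x x \<le> C / real N" by (intro tendsto_upperbound[of "err N x"]) auto
    thus ?thesis using True by simp
  qed
  thus ?thesis unfolding err_def eventually_sequentially by blast
qed

end
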